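(* Let $G$ be a $\frac{3}{2}$-tough $2K_2$-free graph with at least three vertices. Then $G$ has a spanning 2-trail.
   Context: All graphs are finite, simple and undirected. A graph $G$ is $2K_2$-free if it does not contain two independent edges as an induced subgraph. For a real number $t\ge 0$, $G$ is $t$-tough if $|S|\ge t\cdot c(G-S)$ for every $S\subseteq V(G)$ with $c(G-S)\ge 2$, where $c(G-S)$ denotes the number of components of $G-S$ (complete graphs are $t$-tough for every $t$). A $k$-walk is a closed walk in which each vertex is repeated at most $k$ times; a $k$-trail is a $k$-walk with no repeated edges. Equivalently, $G$ has a spanning 2-trail if and only if $G$ has a connected spanning subgraph in which every vertex has even degree and maximum degree at most $4$. *)

theory Defs
  imports Complex_Main "Graph_Theory.Digraph_Component" "Graph_Theory.Vertex_Walk"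
begin

text \<open>
  A finite simple undirected graph is an instance of the locale \<open>graph\<close>: every undirected edge
  $uv$ is represented by the two arcs $(u,v)$ and $(v,u)$.
\<close>

definition is_2K2 :: "('a, 'b) pre_digraph \<Rightarrow> bool" where
  "is_2K2 H \<longleftrightarrow> (\<exists>a b c d. distinct [a, b, c, d] \<and> verts H = {a, b, c, d} \<and>
     arcs_ends H = {(a, b), (b, a), (c, d), (d, c)})"

definition two_K2_free :: "('a, 'b) pre_digraph \<Rightarrow> bool" where
  "two_K2_free G \<longleftrightarrow> \<not> (\<exists>H. induced_subgraph H G \<and> is_2K2 H)"

definition delete_verts :: "('a, 'b) pre_digraph \<Rightarrow> 'a set \<Rightarrow> ('a, 'b) pre_digraph" where
  "delete_verts G S = G \<restriction> (verts G - S)"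

text \<open>
  As the arcs are symmetric, the strongly connected components are the connected components of
  the undirected graph. They are nonempty, so the graph without vertices has none.
\<close>

definition num_components :: "('a, 'b) pre_digraph \<Rightarrow> nat" where
  "num_components G = card (pre_digraph.sccs G)"

definition tough :: "real \<Rightarrow> ('a, 'b) pre_digraph \<Rightarrow> bool" where
  "tough t G \<longleftrightarrow> (\<forall>S \<subseteq> verts G. num_components (delete_verts G S) \<ge> 2 \<longrightarrow>
     real (card S) \<ge> t * real (num_components (delete_verts G S)))"

text \<open>
  A closed walk is a vertex list $v_0, \ldots, v_m$ with $v_m = v_0$. The start vertex is listed
  at both ends but visited only once there, so visits are counted in $v_1, \ldots, v_m$.
\<close>

definition closed_vwalk :: "'a vwalk \<Rightarrow> ('a, 'b) pre_digraph \<Rightarrow> bool" where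
  "closed_vwalk p G \<longleftrightarrow> vwalk p G \<and> hd p = last p"

definition k_walk :: "nat \<Rightarrow> 'a vwalk \<Rightarrow> ('a, 'b) pre_digraph \<Rightarrow> bool" where
  "k_walk k p G \<longleftrightarrow> closed_vwalk p G \<and> (\<forall>v. count_list (tl p) v \<le> k)"

text \<open>
  Edges are undirected: traversing $uv$ once in each direction repeats an edge, hence
  distinctness of the arcs would not be enough.
\<close>

definition vwalk_edges :: "'a vwalk \<Rightarrow> 'a set list" where
  "vwalk_edges p = map (\<lambda>(u, v). {u, v}) (vwalk_arcs p)"

definition k_trail :: "nat \<Rightarrow> 'a vwalk \<Rightarrow> ('a, 'b) pre_digraph \<Rightarrow> bool" where
  "k_trail k p G \<longleftrightarrow> k_walk k p G \<and> distinct (vwalk_edges p)"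

definition has_spanning_k_trail :: "nat \<Rightarrow> ('a, 'b) pre_digraph \<Rightarrow> bool" where
  "has_spanning_k_trail k G \<longleftrightarrow> (\<exists>p. k_trail k p G \<and> set p = verts G)"

end

theory Submission
  imports Defs
begin

text \<open>
  Let \<open>C\<close> be a longest cycle with vertex set \<open>K\<close>. As the graph is \<open>2K\<^sub>2\<close>-free and more
  than 1-tough, the set \<open>I\<close> of the remaining vertices is independent. It therefore suffices to find
  a set \<open>R\<close> of further edges such that \<open>C \<union> R\<close>, up to the removal of one edge of \<open>C\<close>, has
  all degrees in \<open>{2, 4}\<close>: connectedness is automatic, and an Euler tour is the desired trail.

  By a Hall-type theorem, 3/2-toughness yields a bipartite \<open>R\<close> with degree 2 on \<open>I\<close> and at
  most 2 on \<open>K\<close>; there is just enough room to ask for degree 3 at one vertex \<open>s \<in> I\<close>. It remains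
  to repair the parity at the loose vertices, those of degree 1 on \<open>K\<close>. Given two of them, \<open>t\<close> and
  \<open>t'\<close>, with edges to different \<open>p, p' \<in> I\<close>, the edges \<open>tp\<close> and \<open>t'p'\<close> do not induce
  \<open>2K\<^sub>2\<close>, so that \<open>R\<close> can be switched to make both of them even, unless \<open>tt'\<close> lies on \<open>C\<close>.
  For a minimal \<open>R\<close> this leaves one or three loose vertices, and a short analysis pairs the last
  ones with \<open>s\<close>, using one edge of \<open>C\<close> if necessary.
\<close>

section \<open>Walks, degrees and Euler tours\<close>

definition deg :: "'a set set \<Rightarrow> 'a \<Rightarrow> nat" where
  "deg H v = card {e \<in> H. v \<in> e}"

text \<open>Says that \<open>U\<close> lies within one component of \<open>H\<close>. Speaking of
  edge-closed sets instead of paths makes this monotone in \<open>H\<close> and lets closure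
  arguments replace the joining of paths.\<close>

definition linked :: "'a set set \<Rightarrow> 'a set \<Rightarrow> bool" where
  "linked H U \<longleftrightarrow> (\<forall>X. X \<inter> U \<noteq> {} \<longrightarrow> (\<forall>e\<in>H. e \<inter> X \<noteq> {} \<longrightarrow> e \<subseteq> X) \<longrightarrow> U \<subseteq> X)"

lemma linkedI:
  "(\<And>X. X \<inter> U \<noteq> {} \<Longrightarrow> (\<And>e. e \<in> H \<Longrightarrow> e \<inter> X \<noteq> {} \<Longrightarrow> e \<subseteq> X) \<Longrightarrow> U \<subseteq> X) \<Longrightarrow> linked H U"
  unfolding linked_def by simp

lemma linkedD:
  "linked H U \<Longrightarrow> X \<inter> U \<noteq> {} \<Longrightarrow> (\<And>e. e \<in> H \<Longrightarrow> e \<inter> X \<noteq> {} \<Longrightarrow> e \<subseteq> X) \<Longrightarrow> U \<subseteq> X"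
  unfolding linked_def by simp

section \<open>Edges of vertex walks\<close>

lemma vwalk_edges_simps [simp]:
  "vwalk_edges [] = []" "vwalk_edges [x] = []"
  "vwalk_edges (x # y # xs) = {x, y} # vwalk_edges (y # xs)"
  by (simp_all add: vwalk_edges_def)

lemma length_vwalk_edges [simp]: "length (vwalk_edges p) = length p - 1"
  by (induct p rule: vwalk_arcs.induct) auto

lemma vwalk_edges_append:
  "vwalk_edges (a @ x # b) = vwalk_edges (a @ [x]) @ vwalk_edges (x # b)"
  by (induct a rule: vwalk_arcs.induct) auto

lemma vwalk_edges_snoc:
  "p \<noteq> [] \<Longrightarrow> vwalk_edges (p @ [w]) = vwalk_edges p @ [{last p, w}]"
  by (induct p rule: vwalk_arcs.induct) auto

lemma vwalk_edges_Cons: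
  "p \<noteq> [] \<Longrightarrow> vwalk_edges (w # p) = {w, hd p} # vwalk_edges p"
  by (cases p) auto

lemma vwalk_edges_append2:
  "p \<noteq> [] \<Longrightarrow> q \<noteq> [] \<Longrightarrow>
    vwalk_edges (p @ q) = vwalk_edges p @ {last p, hd q} # vwalk_edges q"
  by (induct p rule: vwalk_arcs.induct) (auto simp: vwalk_edges_Cons)

lemma vwalk_edges_rev: "vwalk_edges (rev p) = rev (vwalk_edges p)"
proof (induct p rule: vwalk_arcs.induct)
  case (3 x y xs)
  then show ?case using vwalk_edges_snoc[of "rev (y # xs)" x] by (simp add: insert_commute)
qed auto

lemma vwalk_edges_subset: "e \<in> set (vwalk_edges p) \<Longrightarrow> e \<subseteq> set p"
  by (induct p rule: vwalk_arcs.induct) auto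

text \<open>Each inner visit to \<open>v\<close> uses two edges of the walk, a visit at either end
  only one, which the two \<open>of_bool\<close> terms make up for. Loops must be excluded, since a
  loop joins two visits but is counted once.\<close>

lemma count_vwalk_edges:
  assumes "p \<noteq> []" "\<And>e. e \<in> set (vwalk_edges p) \<Longrightarrow> card e = 2"
  shows "2 * count_list p v =
    length (filter (\<lambda>e. v \<in> e) (vwalk_edges p)) + of_bool (v = hd p) + of_bool (v = last p)"
  using assms
proof (induct p rule: vwalk_arcs.induct)
  case (3 x y xs)
  have "x \<noteq> y" using 3(3)[of "{x, y}"] by auto
  then show ?case using 3 by auto
qed auto

section \<open>Euler tours\<close>

lemma length_filter_distinct:
  "distinct xs \<Longrightarrow> length (filter P xs) = card {x \<in> set xs. P x}"
  by (metis distinct_card distinct_filter set_filter)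

text \<open>A closed walk can be cut open at any vertex that it visits. The order of the edges
  changes, but their multiset decides both distinctness and the edge set.\<close>

lemma closed_trail_rotate:
  assumes "x \<in> set p" "p \<noteq> []" "hd p = last p"
  shows "\<exists>q. q \<noteq> [] \<and> last q = x \<and> length q = length p \<and> mset (vwalk_edges q) = mset (vwalk_edges p)"
proof -
  obtain a b where p: "p = a @ x # b" using assms(1) by (meson split_list)
  show ?thesis
  proof (cases a)
    case Nil
    then have "last p = x" using assms(3) p by simp
    then show ?thesis using assms(2) by blast
  next
    case (Cons h a')
    have "last (x # b) = h" using assms(3) p Cons by simp
    then have c: "x # b = butlast (x # b) @ [h]" using append_butlast_last_id[of "x # b"] by simp
    define c where "c = butlast (x # b)"
    note c = c[folded c_def]
    have "vwalk_edges p = vwalk_edges (h # a' @ [x]) @ vwalk_edges (c @ [h])"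
      using p Cons c vwalk_edges_append[of a x b] by simp
    moreover have "vwalk_edges (c @ h # a' @ [x]) = vwalk_edges (c @ [h]) @ vwalk_edges (h # a' @ [x])"
      by (rule vwalk_edges_append)
    moreover have "length p = length (c @ h # a' @ [x])"
      using p Cons arg_cong[OF c, of length] by simp
    ultimately have "mset (vwalk_edges (c @ h # a' @ [x])) = mset (vwalk_edges p)"
      and "length (c @ h # a' @ [x]) = length p" by simp_all
    then show ?thesis by (intro exI[of _ "c @ h # a' @ [x]"]) simp
  qed
qed

text \<open>A longest trail has used every edge at its last vertex, so parity forces it to be
  closed. It can then be rotated to end at any of its vertices, so every edge meeting it is used,
  and \<open>linked\<close> does the rest.\<close>

lemma euler:
  assumes fin: "finite H" and two: "\<And>e. e \<in> H \<Longrightarrow> card e = 2" and "H \<noteq> {}"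
    and ev: "\<And>v. even (deg H v)" and conn: "linked H (\<Union>H)"
  shows "\<exists>p. p \<noteq> [] \<and> hd p = last p \<and> distinct (vwalk_edges p) \<and> set (vwalk_edges p) = H"
proof -
  define trail where
    "trail p \<longleftrightarrow> p \<noteq> [] \<and> distinct (vwalk_edges p) \<and> set (vwalk_edges p) \<subseteq> H" for p :: "'a list"
  have bound: "length p < Suc (Suc (card H))" if "trail p" for p
  proof -
    have "length (vwalk_edges p) \<le> card H"
      using that fin by (metis card_mono distinct_card trail_def)
    then show ?thesis by simp
  qed
  obtain e where e: "e \<in> H" using \<open>H \<noteq> {}\<close> by blast
  then obtain u v where uv: "e = {u, v}" using two by (meson card_2_iff)
  have start: "trail [u, v]" using e uv by (simp add: trail_def)
  obtain p where p: "trail p" and max: "\<And>q. trail q \<Longrightarrow> length q \<le> length p"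
    using ex_has_greatest_nat[of trail, OF start] bound by (metis less_Suc_eq_le)
  \<comment> \<open>Stated for every \<open>q\<close> with the length and the edges of
    \<open>p\<close>, so that it applies to \<open>p\<close> itself and, once \<open>p\<close> is
    known to be closed, to all its rotations.\<close>
  have extend: "e \<in> set (vwalk_edges p)"
    if q: "q \<noteq> []" "length q = length p" "mset (vwalk_edges q) = mset (vwalk_edges p)"
      and e: "e \<in> H" "last q \<in> e" for q e
  proof (rule ccontr)
    assume nin: "e \<notin> set (vwalk_edges p)"
    obtain w where w: "e = {last q, w}"
      using e two by (metis card_2_iff insert_iff singletonD insert_commute)
    have "distinct (vwalk_edges q)" "set (vwalk_edges q) = set (vwalk_edges p)"
      using q(3) p unfolding trail_def by (metis mset_eq_imp_distinct_iff, metis mset_eq_setD)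
    then have "trail (q @ [w])"
      using q p e nin w by (auto simp: trail_def vwalk_edges_snoc)
    from max[OF this] show False using q(2) by simp
  qed
  have pne: "p \<noteq> []" and dist: "distinct (vwalk_edges p)" and sub: "set (vwalk_edges p) \<subseteq> H"
    using p by (auto simp: trail_def)
  \<comment> \<open>All edges at \<open>last p\<close> are on the trail, so their number is even; an
    open trail would use an odd number of edges at its end.\<close>
  have "{e \<in> H. last p \<in> e} = {e \<in> set (vwalk_edges p). last p \<in> e}"
    using extend[of p] pne sub by auto
  then have "even (length (filter (\<lambda>e. last p \<in> e) (vwalk_edges p)))"
    using ev[of "last p"] by (simp add: deg_def length_filter_distinct[OF dist])
  moreover have "2 * count_list p (last p) =
      length (filter (\<lambda>e. last p \<in> e) (vwalk_edges p)) + of_bool (last p = hd p) + 1"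
    using count_vwalk_edges[OF pne, of "last p"] two sub by (simp add: subset_iff)
  ultimately have "even (of_bool (last p = hd p) + 1 :: nat)"
    by (metis add.assoc dvd_triv_left even_add)
  then have closed: "hd p = last p" by (cases "last p = hd p") simp_all
  have used: "e \<in> set (vwalk_edges p)" if "e \<in> H" "x \<in> e" "x \<in> set p" for e x
    using closed_trail_rotate[OF that(3) pne closed] extend that by blast
  have "\<Union>H \<subseteq> set p"
  proof (rule linkedD[OF conn])
    have "length p \<ge> 2" using max[OF start] by simp
    then obtain a b r where "p = a # b # r" by (metis Suc_le_length_iff numeral_2_eq_2)
    then show "set p \<inter> \<Union>H \<noteq> {}" using sub by auto
    show "e \<subseteq> set p" if "e \<in> H" "e \<inter> set p \<noteq> {}" for e
      using used that vwalk_edges_subset by (metis disjoint_iff)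
  qed
  have "H \<subseteq> set (vwalk_edges p)"
  proof
    fix e assume e: "e \<in> H"
    then obtain x where "x \<in> e" using two by fastforce
    then show "e \<in> set (vwalk_edges p)" using used e \<open>\<Union>H \<subseteq> set p\<close> by blast
  qed
  then show ?thesis using pne closed dist sub by blast
qed

section \<open>Cycles as lists of distinct vertices\<close>

definition cycle_edges :: "'a list \<Rightarrow> 'a set set" where
  "cycle_edges xs = set (vwalk_edges (xs @ [hd xs]))"

lemma cycle_edges_eq: "xs \<noteq> [] \<Longrightarrow> cycle_edges xs = insert {last xs, hd xs} (set (vwalk_edges xs))"
  by (simp add: cycle_edges_def vwalk_edges_snoc)

lemma distinct_vwalk_edges: "distinct p \<Longrightarrow> distinct (vwalk_edges p)"
proof (induct p rule: vwalk_arcs.induct)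
  case (3 x y xs)
  then show ?case using vwalk_edges_subset[of "{x, y}" "y # xs"] by auto
qed auto

lemma card_vwalk_edge: "distinct p \<Longrightarrow> e \<in> set (vwalk_edges p) \<Longrightarrow> card e = 2"
  by (induct p rule: vwalk_arcs.induct) auto

text \<open>Among the edges of the path only the first contains \<open>hd xs\<close>, and with three
  or more vertices its other end is not \<open>last xs\<close>.\<close>

lemma distinct_cycle_edges:
  assumes "distinct xs" "length xs \<ge> 3"
  shows "distinct (vwalk_edges (xs @ [hd xs]))"
proof -
  obtain x y z r where xs: "xs = x # y # z # r"
    using assms(2) by (metis Suc_le_length_iff numeral_3_eq_3)
  have "{last xs, hd xs} \<notin> set (vwalk_edges xs)"
  proof
    assume a: "{last xs, hd xs} \<in> set (vwalk_edges xs)"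
    have "last xs \<in> set (z # r)" using xs by auto
    then have "{last xs, hd xs} \<noteq> {x, y}" using xs assms(1) by (auto simp: doubleton_eq_iff)
    then have "{last xs, hd xs} \<in> set (vwalk_edges (y # z # r))" using a xs by simp
    then have "hd xs \<in> set (y # z # r)" using vwalk_edges_subset by blast
    then show False using xs assms(1) by auto
  qed
  moreover have "xs \<noteq> []" using xs by simp
  ultimately show ?thesis
    unfolding vwalk_edges_snoc[OF \<open>xs \<noteq> []\<close>] using distinct_vwalk_edges[OF assms(1)]
    by simp
qed

lemma card_cycle_edge:
  assumes "distinct xs" "length xs \<ge> 3" "e \<in> cycle_edges xs"
  shows "card e = 2"
proof -
  obtain x y r where xs: "xs = x # y # r" "r \<noteq> []"
    using assms(2) by (metis Suc_le_length_iff numeral_3_eq_3 list.distinct(1))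
  then have "last xs \<in> set (y # r)" by auto
  moreover have "hd xs \<notin> set (y # r)" using xs assms(1) by auto
  ultimately have "last xs \<noteq> hd xs" by metis
  then have "card {last xs, hd xs} = 2" by simp
  moreover have "xs \<noteq> []" using xs by simp
  ultimately show ?thesis
    using assms(3) card_vwalk_edge[OF assms(1)] unfolding cycle_edges_eq[OF \<open>xs \<noteq> []\<close>] by blast
qed

lemma card_cycle_edges:
  assumes "distinct xs" "length xs \<ge> 3"
  shows "card (cycle_edges xs) = length xs"
  using distinct_card[OF distinct_cycle_edges[OF assms]] by (simp add: cycle_edges_def)

lemma deg_cycle_edges:
  assumes "distinct xs" "length xs \<ge> 3"
  shows "deg (cycle_edges xs) v = (if v \<in> set xs then 2 else 0)"
proof -
  have ne: "xs \<noteq> []" using assms(2) by auto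
  have "2 * count_list (xs @ [hd xs]) v =
      length (filter (\<lambda>e. v \<in> e) (vwalk_edges (xs @ [hd xs]))) +
      of_bool (v = hd (xs @ [hd xs])) + of_bool (v = last (xs @ [hd xs]))"
    using card_cycle_edge[OF assms] by (intro count_vwalk_edges) (auto simp: cycle_edges_def)
  also have "length (filter (\<lambda>e. v \<in> e) (vwalk_edges (xs @ [hd xs]))) = deg (cycle_edges xs) v"
    by (simp add: length_filter_distinct[OF distinct_cycle_edges[OF assms]] deg_def cycle_edges_def)
  moreover have "count_list xs v = of_bool (v \<in> set xs)"
    using assms(1) by (induct xs) auto
  ultimately show ?thesis
    using ne by (cases "v = hd xs") auto
qed

lemma cycle_rotate:
  assumes "x \<in> set xs"
  shows "\<exists>ys. ys \<noteq> [] \<and> hd ys = x \<and> mset ys = mset xs \<and> cycle_edges ys = cycle_edges xs"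
proof -
  obtain a b where xs: "xs = a @ x # b" using assms by (meson split_list)
  show ?thesis
  proof (cases a)
    case Nil
    then show ?thesis using xs by (intro exI[of _ xs]) auto
  next
    case (Cons h a')
    have "cycle_edges xs = set (vwalk_edges (a @ [x])) \<union> set (vwalk_edges (x # b @ [h]))"
      unfolding cycle_edges_def xs using vwalk_edges_append[of a x "b @ [h]"] Cons by simp
    moreover have "cycle_edges (x # b @ a) = set (vwalk_edges ((x # b) @ [h])) \<union> set (vwalk_edges (h # a' @ [x]))"
      unfolding cycle_edges_def using Cons vwalk_edges_append[of "x # b" h "a' @ [x]"] by simp
    ultimately show ?thesis
      using xs Cons by (intro exI[of _ "x # b @ a"]) auto
  qed
qed

text \<open>Any edge can be made the closing one, so that the rest of the cycle is a path. Edges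
  being unordered, the orientation is left open here.\<close>

lemma cycle_rotate_edge:
  assumes "e \<in> cycle_edges xs" "xs \<noteq> []"
  shows "\<exists>ys. ys \<noteq> [] \<and> e = {last ys, hd ys} \<and> mset ys = mset xs \<and> cycle_edges ys = cycle_edges xs"
proof -
  have split: "\<exists>a x y b. p = a @ x # y # b \<and> e = {x, y}" if "e \<in> set (vwalk_edges p)" for p :: "'a list"
    using that
  proof (induct p rule: vwalk_arcs.induct)
    case (3 x y xs)
    show ?case
    proof (cases "e = {x, y}")
      case True
      then show ?thesis by (metis append_Nil)
    next
      case False
      then have "\<exists>a x' y' b. y # xs = a @ x' # y' # b \<and> e = {x', y'}" using 3 by simp
      then show ?thesis by (metis append_Cons)
    qed
  qed auto
  show ?thesis
  proof (cases "e = {last xs, hd xs}")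
    case True
    then show ?thesis using assms by blast
  next
    case False
    then have "e \<in> set (vwalk_edges xs)" using assms by (simp add: cycle_edges_eq)
    then obtain a x y b where xs: "xs = a @ x # y # b" and e: "e = {x, y}" using split by blast
    define h where "h = hd (a @ [x])"
    have h: "a @ [x] = h # tl (a @ [x])" unfolding h_def by (metis Nil_is_append_conv hd_Cons_tl not_Cons_self2)
    have hx: "hd xs = h" unfolding xs h_def by (cases a) auto
    let ?ys = "(y # b) @ (a @ [x])"
    have "cycle_edges xs = set (vwalk_edges ((a @ [x]) @ [y])) \<union> set (vwalk_edges ((y # b) @ [h]))"
      unfolding cycle_edges_def hx using vwalk_edges_append[of "a @ [x]" y "b @ [h]"] xs by simp
    moreover have "cycle_edges ?ys = set (vwalk_edges ((y # b) @ [h])) \<union> set (vwalk_edges ((a @ [x]) @ [y]))"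
    proof -
      have "?ys @ [hd ?ys] = (y # b) @ h # (tl (a @ [x]) @ [y])" using h by (metis append_Cons append_assoc list.sel(1))
      then have e1: "vwalk_edges (?ys @ [hd ?ys]) = vwalk_edges ((y # b) @ [h]) @ vwalk_edges (h # tl (a @ [x]) @ [y])"
        using vwalk_edges_append[of "y # b" h "tl (a @ [x]) @ [y]"] by (simp only:)
      have e2: "h # tl (a @ [x]) @ [y] = (a @ [x]) @ [y]" using h by (metis append_Cons)
      show ?thesis unfolding cycle_edges_def e1 unfolding e2 by (simp only: set_append)
    qed
    ultimately show ?thesis using xs e by (intro exI[of _ ?ys]) (auto simp: insert_commute)
  qed
qed

lemma linked_path: "linked (set (vwalk_edges p)) (set p)"
proof (induct p rule: vwalk_arcs.induct)
  case (3 x y xs)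
  show ?case
  proof (rule linkedI)
    fix X
    assume m: "X \<inter> set (x # y # xs) \<noteq> {}"
      and cl: "\<And>e. e \<in> set (vwalk_edges (x # y # xs)) \<Longrightarrow> e \<inter> X \<noteq> {} \<Longrightarrow> e \<subseteq> X"
    have xy: "x \<in> X \<longleftrightarrow> y \<in> X" using cl[of "{x, y}"] by auto
    then have "X \<inter> set (y # xs) \<noteq> {}" using m by auto
    then have "set (y # xs) \<subseteq> X" using cl by (intro linkedD[OF 3]) auto
    then show "set (x # y # xs) \<subseteq> X" using xy by auto
  qed
qed (auto simp: linked_def)

lemma linked_mono: "linked H U \<Longrightarrow> H \<subseteq> H' \<Longrightarrow> linked H' U"
  unfolding linked_def subset_iff by meson

text \<open>After a rotation \<open>e\<close> is the closing edge, and a path through all vertices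
  remains. If \<open>e\<close> is no edge of the cycle nothing is deleted, so \<open>e = {}\<close>
  gives the connectedness of the cycle itself.\<close>

lemma linked_cycle_remove_edge:
  assumes "distinct xs" "length xs \<ge> 3"
  shows "linked (cycle_edges xs - {e}) (set xs)"
proof -
  have ne: "xs \<noteq> []" using assms by auto
  have ex: "\<exists>ys. ys \<noteq> [] \<and> mset ys = mset xs \<and> cycle_edges ys = cycle_edges xs \<and>
      set (vwalk_edges ys) \<subseteq> cycle_edges xs - {e}"
  proof (cases "e \<in> cycle_edges xs")
    case True
    then obtain ys where ys: "ys \<noteq> []" "e = {last ys, hd ys}" "mset ys = mset xs" "cycle_edges ys = cycle_edges xs"
      using cycle_rotate_edge[OF _ ne] by blast
    have "distinct ys" "length ys \<ge> 3" using ys(3) assms mset_eq_imp_distinct_iff mset_eq_length by metis+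
    then have "e \<notin> set (vwalk_edges ys)"
      using distinct_cycle_edges[of ys] ys by (simp add: vwalk_edges_snoc)
    then show ?thesis using ys by (auto simp: cycle_edges_eq)
  next
    case False
    then show ?thesis using ne by (intro exI[of _ xs]) (auto simp: cycle_edges_eq)
  qed
  then obtain ys where ys: "mset ys = mset xs" "set (vwalk_edges ys) \<subseteq> cycle_edges xs - {e}" by blast
  have "set ys = set xs" using ys(1) by (rule mset_eq_setD)
  with linked_mono[OF linked_path ys(2)] show ?thesis by (simp only:)
qed

section \<open>Counting degrees\<close>

lemma sum_deg:
  assumes "finite H" "finite A"
  shows "(\<Sum>v\<in>A. deg H v) = (\<Sum>e\<in>H. card (e \<inter> A))"
proof -
  have "(\<Sum>v\<in>A. deg H v) = (\<Sum>v\<in>A. \<Sum>e\<in>H. of_bool (v \<in> e))"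
    using assms by (simp add: deg_def Int_def)
  also have "\<dots> = (\<Sum>e\<in>H. \<Sum>v\<in>A. of_bool (v \<in> e))" by (rule sum.swap)
  also have "\<dots> = (\<Sum>e\<in>H. card (e \<inter> A))"
    using assms by (intro sum.cong) (auto simp: Int_def conj_commute)
  finally show ?thesis .
qed

lemma deg_insert:
  assumes "finite H" "e \<notin> H"
  shows "deg (insert e H) v = deg H v + of_bool (v \<in> e)"
proof -
  have "{f \<in> insert e H. v \<in> f} = (if v \<in> e then insert e {f \<in> H. v \<in> f} else {f \<in> H. v \<in> f})"
    by auto
  then show ?thesis using assms by (simp add: deg_def)
qed

lemma deg_pos:
  assumes "finite H" "e \<in> H" "v \<in> e"
  shows "deg H v > 0"
  using assms by (auto simp: deg_def card_gt_0_iff)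

lemma deg_Un:
  assumes "finite H" "finite H'" "H \<inter> H' = {}"
  shows "deg (H \<union> H') v = deg H v + deg H' v"
proof -
  have "{e \<in> H \<union> H'. v \<in> e} = {e \<in> H. v \<in> e} \<union> {e \<in> H'. v \<in> e}" by auto
  then show ?thesis using assms by (simp add: deg_def card_Un_disjoint disjoint_iff)
qed

lemma deg_empty: "deg {} v = 0"
  by (simp add: deg_def)

lemma deg_eq_0:
  assumes "\<And>e. e \<in> H \<Longrightarrow> v \<notin> e"
  shows "deg H v = 0"
proof -
  have none: "{e \<in> H. v \<in> e} = {}" using assms by blast
  show ?thesis unfolding deg_def none by simp
qed

lemma deg_single: "deg {e} v = of_bool (v \<in> e)"
  using deg_insert[of "{}" e v] by (simp add: deg_empty)

lemma deg_pair: "e \<noteq> f \<Longrightarrow> deg {e, f} v = of_bool (v \<in> e) + of_bool (v \<in> f)"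
  using deg_insert[of "{f}" e v] by (simp add: deg_single)

lemma deg_triple:
  "e \<noteq> f \<Longrightarrow> e \<noteq> g \<Longrightarrow> f \<noteq> g \<Longrightarrow> deg {e, f, g} v = of_bool (v \<in> e) + of_bool (v \<in> f) + of_bool (v \<in> g)"
  using deg_insert[of "{f, g}" e v] by (simp add: deg_pair)

text \<open>Stated additively in order to avoid truncated subtraction.\<close>

lemma deg_toggle:
  assumes "finite H" "finite Add" "Rem \<subseteq> H" "Add \<inter> H = {}"
  shows "deg ((H - Rem) \<union> Add) v + deg Rem v = deg H v + deg Add v"
proof -
  have "deg ((H - Rem) \<union> Add) v = deg (H - Rem) v + deg Add v"
    using assms by (intro deg_Un) auto
  moreover have "deg ((H - Rem) \<union> Rem) v = deg (H - Rem) v + deg Rem v"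
    using assms finite_subset by (intro deg_Un) auto
  moreover have "(H - Rem) \<union> Rem = H" using assms by blast
  ultimately show ?thesis by simp
qed

lemma deg_1_unique:
  assumes "deg R k = 1" "e \<in> R" "k \<in> e" "f \<in> R" "k \<in> f"
  shows "e = f"
  using assms card_1_singletonE[of "{e \<in> R. k \<in> e}"] unfolding deg_def by (metis (mono_tags, lifting) mem_Collect_eq singletonD)

lemma vwalk_edges_cover: "2 \<le> length p \<Longrightarrow> set p \<subseteq> \<Union>(set (vwalk_edges p))"
proof (induct p rule: vwalk_arcs.induct)
  case (3 x y xs)
  then show ?case by (cases xs) auto
qed auto

section \<open>Hall's theorem with capacities\<close>

text \<open>Induction on the number of sets. If every nonempty proper subfamily has an element to
  spare, one choice can be made freely; otherwise a tight subfamily \<open>J\<close> splits the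
  problem into \<open>J\<close> and the rest, which must avoid the union over
  \<open>J\<close>.\<close>

theorem hall_marriage:
  fixes A :: "'i \<Rightarrow> 'x set"
  assumes "finite L" "\<And>l. l \<in> L \<Longrightarrow> finite (A l)"
    and "\<And>J. J \<subseteq> L \<Longrightarrow> card J \<le> card (\<Union>(A ` J))"
  shows "\<exists>f. inj_on f L \<and> (\<forall>l\<in>L. f l \<in> A l)"
  using assms
proof (induct "card L" arbitrary: L A rule: less_induct)
  case less
  note fin = less.prems(1) less.prems(2) and hall = less.prems(3)
  have finU: "finite (\<Union>(A ` J))" if "J \<subseteq> L" for J
    using that fin finite_subset by (metis finite_UN subsetD)
  show ?case
  proof (cases "L = {}")
    case True
    then show ?thesis by simp
  next
    case False
    then obtain l where l: "l \<in> L" by blast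
    show ?thesis
    proof (cases "\<exists>J. J \<subset> L \<and> J \<noteq> {} \<and> card (\<Union>(A ` J)) \<le> card J")
      case False
      have "card (\<Union>(A ` {l})) \<ge> card {l}" using hall[of "{l}"] l by simp
      then have "A l \<noteq> {}" by auto
      then obtain x where x: "x \<in> A l" by blast
      have "\<exists>f. inj_on f (L - {l}) \<and> (\<forall>l'\<in>L - {l}. f l' \<in> A l' - {x})"
      proof (rule less.hyps)
        show "card (L - {l}) < card L" using l fin by (meson card_Diff1_less)
        show "finite (L - {l})" "\<And>l'. l' \<in> L - {l} \<Longrightarrow> finite (A l' - {x})" using fin by auto
        show "card J \<le> card (\<Union>l'\<in>J. A l' - {x})" if J: "J \<subseteq> L - {l}" for J
        proof (cases "J = {}")
          case False
          have "J \<subset> L" using J l by blast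
          then have "card J < card (\<Union>(A ` J))"
            using False \<open>\<nexists>J. J \<subset> L \<and> J \<noteq> {} \<and> card (\<Union>(A ` J)) \<le> card J\<close> by (meson not_less)
          moreover have "(\<Union>l'\<in>J. A l' - {x}) = \<Union>(A ` J) - {x}" by blast
          moreover have "card (\<Union>(A ` J)) - 1 \<le> card (\<Union>(A ` J) - {x})"
            by (simp add: diff_card_le_card_Diff[of "{x}", simplified])
          ultimately show ?thesis by simp
        qed simp
      qed
      then obtain f where f: "inj_on f (L - {l})" "\<And>l'. l' \<in> L - {l} \<Longrightarrow> f l' \<in> A l' - {x}" by blast
      have "inj_on (f(l := x)) L"
        using f by (auto simp: inj_on_def)
      moreover have "\<forall>l'\<in>L. (f(l := x)) l' \<in> A l'" using f x by auto
      ultimately show ?thesis by blast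
    next
      case True
      then obtain J where J: "J \<subset> L" "J \<noteq> {}" "card (\<Union>(A ` J)) \<le> card J" by blast
      have finJ: "finite J" using J fin finite_subset by blast
      have "\<exists>f. inj_on f J \<and> (\<forall>l\<in>J. f l \<in> A l)"
        using J fin hall finJ by (intro less.hyps) (auto intro: psubset_card_mono)
      then obtain f where f: "inj_on f J" "\<And>l. l \<in> J \<Longrightarrow> f l \<in> A l" by blast
      have "\<exists>g. inj_on g (L - J) \<and> (\<forall>l\<in>L - J. g l \<in> A l - \<Union>(A ` J))"
      proof (rule less.hyps)
        show "card (L - J) < card L" using J fin by (intro psubset_card_mono) auto
        show "finite (L - J)" "\<And>l. l \<in> L - J \<Longrightarrow> finite (A l - \<Union>(A ` J))" using fin by auto
        show "card J' \<le> card (\<Union>l\<in>J'. A l - \<Union>(A ` J))" if J': "J' \<subseteq> L - J" for J'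
        proof -
          have finJ': "finite J'" using J' fin finite_subset by blast
          \<comment> \<open>Hall's condition for \<open>J' \<union> J\<close>, reduced by the tight
            \<open>J\<close>, is the condition for \<open>J'\<close> among the remaining
            elements.\<close>
          have "card J' + card J = card (J' \<union> J)"
            using J' finJ finJ' by (subst card_Un_disjoint) auto
          also have "\<dots> \<le> card (\<Union>(A ` (J' \<union> J)))" using J J' by (intro hall) auto
          also have "\<Union>(A ` (J' \<union> J)) = (\<Union>l\<in>J'. A l - \<Union>(A ` J)) \<union> \<Union>(A ` J)" by blast
          also have "card \<dots> \<le> card (\<Union>l\<in>J'. A l - \<Union>(A ` J)) + card (\<Union>(A ` J))"
            by (rule card_Un_le)
          finally show ?thesis using J(3) by simp
        qed
      qed
      then obtain g where g: "inj_on g (L - J)" "\<And>l. l \<in> L - J \<Longrightarrow> g l \<in> A l - \<Union>(A ` J)" by blast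
      let ?h = "\<lambda>l. if l \<in> J then f l else g l"
      have "f a \<noteq> g b" if "a \<in> J" "b \<in> L - J" for a b
        using f(2)[OF that(1)] g(2)[OF that(2)] that(1) by auto
      then have "inj_on ?h L"
        using f(1) g(1) by (auto simp: inj_on_def) metis
      moreover have "\<forall>l\<in>L. ?h l \<in> A l" using f(2) g(2) by auto
      ultimately show ?thesis by blast
    qed
  qed
qed

text \<open>
  Hall's theorem is applied to the incidences \<open>(v, k)\<close>: each of them is matched either to one of
  the \<open>c\<close> places at \<open>k\<close>, or to one of the \<open>card (N v) - b v\<close> rejections that \<open>v\<close> can afford.
\<close>

lemma capacitated_matching:
  fixes N :: "'i \<Rightarrow> 'k set"
  assumes fin: "finite I" "finite K" and N: "\<And>v. v \<in> I \<Longrightarrow> N v \<subseteq> K"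
    and cond: "\<And>X Y. X \<subseteq> I \<Longrightarrow> Y \<subseteq> K \<Longrightarrow>
      (\<Sum>v\<in>X. b v) \<le> c * card Y + (\<Sum>v\<in>X. card (N v - Y))"
  shows "\<exists>M. (\<forall>v\<in>I. M v \<subseteq> N v \<and> card (M v) = b v) \<and> (\<forall>k. card {v \<in> I. k \<in> M v} \<le> c)"
proof -
  have finN: "finite (N v)" if "v \<in> I" for v using N[OF that] fin finite_subset by blast
  \<comment> \<open>The instance \<open>Y = {}\<close> ensures that the difference
    \<open>card (N v) - b v\<close> is not truncated.\<close>
  have bN: "b v \<le> card (N v)" if "v \<in> I" for v using cond[of "{v}" "{}"] that by simp
  define A :: "'i \<times> 'k \<Rightarrow> ('k \<times> nat + 'i \<times> nat) set"
    where "A = (\<lambda>(v, k). Inl ` ({k} \<times> {..<c}) \<union> Inr ` ({v} \<times> {..<card (N v) - b v}))"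
  have "\<exists>f. inj_on f (Sigma I N) \<and> (\<forall>l\<in>Sigma I N. f l \<in> A l)"
  proof (rule hall_marriage)
    show "finite (Sigma I N)" using fin finN by auto
    show "finite (A l)" if "l \<in> Sigma I N" for l by (auto simp: A_def split: prod.split)
    show "card J \<le> card (\<Union>(A ` J))" if J: "J \<subseteq> Sigma I N" for J
    proof -
      \<comment> \<open>The union over \<open>J\<close> depends only on the projections
        \<open>X\<close> and \<open>Y\<close>, so the worst \<open>J\<close> consists of all
        incidences between them. For it Hall's condition is \<open>cond\<close>, up to the identity
        \<open>card (N v \<inter> Y) + card (N v - Y) = card (N v)\<close>.\<close>
      define X where "X = fst ` J"
      define Y where "Y = snd ` J"
      have X: "X \<subseteq> I" and Y: "Y \<subseteq> K" using J N unfolding X_def Y_def by fastforce+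
      have finX: "finite X" and finY: "finite Y" using X Y fin finite_subset by blast+
      have U: "\<Union>(A ` J) = Inl ` (Y \<times> {..<c}) \<union> Inr ` (Sigma X (\<lambda>v. {..<card (N v) - b v}))"
        unfolding A_def X_def Y_def by (auto 0 3 split: prod.splits simp: image_iff) force+
      have "card (\<Union>(A ` J)) = card (Y \<times> {..<c}) + card (Sigma X (\<lambda>v. {..<card (N v) - b v}))"
        unfolding U using finX finY
        by (subst card_Un_disjoint) (auto simp: card_image inj_on_def)
      then have cU: "card (\<Union>(A ` J)) = c * card Y + (\<Sum>v\<in>X. card (N v) - b v)"
        using finX by (simp add: card_SigmaI card_cartesian_product mult.commute)
      have "J \<subseteq> Sigma X (\<lambda>v. N v \<inter> Y)" using J unfolding X_def Y_def by (force simp: image_iff)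
      then have "card J \<le> card (Sigma X (\<lambda>v. N v \<inter> Y))"
        using finX finY by (intro card_mono) auto
      then have cJ: "card J \<le> (\<Sum>v\<in>X. card (N v \<inter> Y))"
        using finX finY by (simp add: card_SigmaI)
      have "(\<Sum>v\<in>X. card (N v \<inter> Y)) + (\<Sum>v\<in>X. card (N v - Y)) = (\<Sum>v\<in>X. card (N v))"
        unfolding sum.distrib[symmetric] using X finN
        by (intro sum.cong refl) (metis card_Int_Diff subsetD)
      moreover have "(\<Sum>v\<in>X. card (N v) - b v) + (\<Sum>v\<in>X. b v) = (\<Sum>v\<in>X. card (N v))"
        unfolding sum.distrib[symmetric] using X bN by (intro sum.cong) auto
      ultimately show ?thesis using cond[OF X Y] cU cJ by linarith
    qed
  qed
  then obtain f where inj: "inj_on f (Sigma I N)" and f: "\<And>v k. v \<in> I \<Longrightarrow> k \<in> N v \<Longrightarrow> f (v, k) \<in> A (v, k)"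
    by blast
  \<comment> \<open>The incidences that received a place. At most \<open>card (N v) - b v\<close>
    are rejected, so at least \<open>b v\<close> remain, and \<open>M\<close> trims them to exactly
    that many.\<close>
  define M0 where "M0 v = {k \<in> N v. f (v, k) \<in> range Inl}" for v
  have "b v \<le> card (M0 v)" if v: "v \<in> I" for v
  proof -
    have "(\<lambda>k. f (v, k)) ` (N v - M0 v) \<subseteq> Inr ` ({v} \<times> {..<card (N v) - b v})"
      using f[OF v] by (fastforce simp: M0_def A_def)
    moreover have "inj_on (\<lambda>k. f (v, k)) (N v - M0 v)"
      using inj v by (auto simp: inj_on_def)
    ultimately have "card (N v - M0 v) \<le> card (Inr ` ({v} \<times> {..<card (N v) - b v}) :: ('k \<times> nat + 'i \<times> nat) set)"
      by (intro card_inj_on_le) auto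
    also have "\<dots> = card (N v) - b v" by (simp add: card_image)
    finally have "card (N v - M0 v) \<le> card (N v) - b v" .
    moreover have "card (N v - M0 v) = card (N v) - card (M0 v)"
      using finN[OF v] by (intro card_Diff_subset) (auto simp: M0_def)
    moreover have "card (M0 v) \<le> card (N v)"
      using finN[OF v] by (intro card_mono) (auto simp: M0_def)
    ultimately show ?thesis using bN[OF v] by linarith
  qed
  then have "\<forall>v\<in>I. \<exists>S. S \<subseteq> M0 v \<and> card S = b v" by (meson obtain_subset_with_card_n)
  then obtain M where M: "\<And>v. v \<in> I \<Longrightarrow> M v \<subseteq> M0 v \<and> card (M v) = b v" by metis
  have "card {v \<in> I. k \<in> M v} \<le> c" for k
  proof -
    have sub: "k \<in> N v" "f (v, k) \<in> range Inl" if "v \<in> I" "k \<in> M v" for v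
      using M[OF that(1)] that(2) by (auto simp: M0_def)
    have "f (v, k) \<in> Inl ` ({k} \<times> {..<c})" if "v \<in> I" "k \<in> M v" for v
      using f[of v k] sub[OF that] that(1) by (auto simp: A_def)
    then have "(\<lambda>v. f (v, k)) ` {v \<in> I. k \<in> M v} \<subseteq> Inl ` ({k} \<times> {..<c})"
      by blast
    moreover have "inj_on (\<lambda>v. f (v, k)) {v \<in> I. k \<in> M v}"
    proof (rule inj_onI)
      fix v w assume "v \<in> {v \<in> I. k \<in> M v}" "w \<in> {v \<in> I. k \<in> M v}" "f (v, k) = f (w, k)"
      then show "v = w" using inj_onD[OF inj, of "(v, k)" "(w, k)"] sub by simp
    qed
    ultimately have "card {v \<in> I. k \<in> M v} \<le> card (Inl ` ({k} \<times> {..<c}) :: ('k \<times> nat + 'i \<times> nat) set)"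
      by (intro card_inj_on_le) auto
    then show ?thesis by (simp add: card_image)
  qed
  then show ?thesis using M by (intro exI[of _ M]) (auto simp: M0_def)
qed

section \<open>Longest cycles in tough \<open>2K\<^sub>2\<close>-free graphs\<close>

text \<open>The assumption \<open>tough\<close> expresses toughness without components: apart from
  \<open>x\<close>, the vertices of \<open>J\<close> become isolated when \<open>S\<close> is
  deleted, so \<open>J\<close> meets \<open>card J\<close> components. The exempt \<open>x\<close>
  may lie in a larger component, so its neighbours need not be deleted; an \<open>x\<close> outside
  \<open>J\<close> exempts nothing.\<close>

locale tough_2K2_free =
  fixes V :: "'a set" and E :: "'a set set"
  assumes finite_V: "finite V"
    and edge: "e \<in> E \<Longrightarrow> \<exists>u v. u \<in> V \<and> v \<in> V \<and> u \<noteq> v \<and> e = {u, v}"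
    and free: "{a, b} \<in> E \<Longrightarrow> {c, d} \<in> E \<Longrightarrow> {a, b} \<inter> {c, d} = {} \<Longrightarrow>
      {a, c} \<in> E \<or> {a, d} \<in> E \<or> {b, c} \<in> E \<or> {b, d} \<in> E"
    and tough: "S \<subseteq> V \<Longrightarrow> J \<subseteq> V - S \<Longrightarrow> 2 \<le> card J \<Longrightarrow>
      (\<And>v w. v \<in> J \<Longrightarrow> v \<noteq> x \<Longrightarrow> {v, w} \<in> E \<Longrightarrow> w \<in> S) \<Longrightarrow> 3 * card J \<le> 2 * card S"
    and card_V: "3 \<le> card V"
begin

section \<open>Minimum degree and existence of cycles\<close>

definition nb :: "'a \<Rightarrow> 'a set" where
  "nb v = {w. {v, w} \<in> E}"

lemma edgeD:
  assumes "{u, v} \<in> E"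
  shows "u \<in> V" "v \<in> V" "u \<noteq> v"
  using edge[OF assms] by (auto simp: doubleton_eq_iff)

lemma finite_E: "finite E"
proof (rule finite_subset)
  show "E \<subseteq> Pow V" using edge by fastforce
qed (simp add: finite_V)

lemma deg_eq_card_nb:
  assumes "R \<subseteq> E"
  shows "deg R v = card {z. {v, z} \<in> R}"
proof -
  have "{e \<in> R. v \<in> e} = (\<lambda>z. {v, z}) ` {z. {v, z} \<in> R}"
  proof
    show "{e \<in> R. v \<in> e} \<subseteq> (\<lambda>z. {v, z}) ` {z. {v, z} \<in> R}"
    proof
      fix e assume "e \<in> {e \<in> R. v \<in> e}"
      then have e: "e \<in> R" "v \<in> e" by simp_all
      then obtain a b where "e = {a, b}" using assms edge by blast
      then obtain z where "e = {v, z}" using e(2) by auto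
      then show "e \<in> (\<lambda>z. {v, z}) ` {z. {v, z} \<in> R}" using e(1) by blast
    qed
  qed auto
  moreover have "inj_on (\<lambda>z. {v, z}) {z. {v, z} \<in> R}" by (auto simp: inj_on_def doubleton_eq_iff)
  ultimately show ?thesis by (simp add: deg_def card_image)
qed

lemma nb_subset: "nb v \<subseteq> V"
  using edgeD by (auto simp: nb_def)

lemma finite_nb: "finite (nb v)"
  using nb_subset finite_V finite_subset by blast

text \<open>Deleting the neighbours of \<open>v\<close> separates it from \<open>w\<close>, so
  toughness applies with two components.\<close>

lemma card_nb_ge_3:
  assumes "v \<in> V" "w \<in> V" "w \<noteq> v" "{v, w} \<notin> E"
  shows "3 \<le> card (nb v)"
proof -
  have "3 * card {v, w} \<le> 2 * card (nb v)"
    using assms nb_subset edgeD(3)[of v v] by (intro tough[where x = w]) (auto simp: nb_def)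
  then show ?thesis using assms(3) by simp
qed

lemma card_nb_ge_2:
  assumes "v \<in> V"
  shows "2 \<le> card (nb v)"
proof (cases "V - {v} \<subseteq> nb v")
  case True
  have "card V - 1 \<le> card (nb v)"
    using card_mono[OF finite_nb True] assms by (simp add: card_Diff_singleton)
  then show ?thesis using card_V by simp
next
  case False
  then show ?thesis using card_nb_ge_3[OF assms] by (fastforce simp: nb_def)
qed

definition cyc :: "'a list \<Rightarrow> bool" where
  "cyc xs \<longleftrightarrow> distinct xs \<and> 3 \<le> length xs \<and> cycle_edges xs \<subseteq> E"

lemma cycI:
  "distinct xs \<Longrightarrow> 3 \<le> length xs \<Longrightarrow> set (vwalk_edges xs) \<subseteq> E \<Longrightarrow> {last xs, hd xs} \<in> E \<Longrightarrow> cyc xs"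
  unfolding cyc_def by (subst cycle_edges_eq) auto

lemma cycD:
  assumes "cyc xs"
  shows "xs \<noteq> []" "set (vwalk_edges xs) \<subseteq> E" "{last xs, hd xs} \<in> E" "set xs \<subseteq> V" "length xs \<le> card V"
proof -
  show ne: "xs \<noteq> []" using assms by (auto simp: cyc_def)
  then show "set (vwalk_edges xs) \<subseteq> E" "{last xs, hd xs} \<in> E"
    using assms by (auto simp: cyc_def cycle_edges_eq)
  show V: "set xs \<subseteq> V"
  proof
    fix v assume "v \<in> set xs"
    then have "deg (cycle_edges xs) v = 2" using assms by (simp add: cyc_def deg_cycle_edges)
    then obtain e where "e \<in> cycle_edges xs" "v \<in> e" unfolding deg_def
      by (metis (mono_tags, lifting) Collect_empty_eq card.empty zero_neq_numeral)
    then show "v \<in> V" using edge assms by (fastforce simp: cyc_def)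
  qed
  show "length xs \<le> card V"
    using card_mono[OF finite_V V] assms by (simp add: cyc_def distinct_card)
qed

text \<open>The first vertex of a longest path has all its neighbours on the path, and at least two
  of them. One that is not the second vertex closes a cycle of length at least three.\<close>

lemma ex_cyc: "\<exists>xs. cyc xs"
proof -
  define path where
    "path p \<longleftrightarrow> p \<noteq> [] \<and> distinct p \<and> set (vwalk_edges p) \<subseteq> E \<and> set p \<subseteq> V" for p
  obtain v where "v \<in> V" using card_V by fastforce
  then have start: "path [v]" by (simp add: path_def)
  have bound: "length p < Suc (card V)" if "path p" for p
    using that finite_V card_mono[of V "set p"] by (simp add: path_def distinct_card)
  obtain p where p: "path p" and max: "\<And>q. path q \<Longrightarrow> length q \<le> length p"
    using ex_has_greatest_nat[of path, OF start] bound by (metis less_Suc_eq_le)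
  obtain x q where xq: "p = x # q" using p by (metis path_def neq_Nil_conv)
  have xV: "x \<in> V" using p xq by (simp add: path_def)
  have nbq: "w \<in> set q" if "w \<in> nb x" for w
  proof (rule ccontr)
    assume "w \<notin> set q"
    then have "path (w # p)"
      using that p edgeD[of x w] xq by (auto simp: path_def nb_def insert_commute)
    from max[OF this] show False by simp
  qed
  have "\<not> nb x \<subseteq> {hd q}"
    using card_nb_ge_2[OF xV] card_mono[of "{hd q}" "nb x"] by auto
  then obtain y where y: "y \<in> nb x" "y \<noteq> hd q" by blast
  obtain a b where q: "q = a @ y # b" using nbq[OF y(1)] by (meson split_list)
  have a: "a \<noteq> []" using y(2) q by auto
  have p_eq: "p = (x # a) @ y # b" using xq q by simp
  have "vwalk_edges p = vwalk_edges ((x # a) @ [y]) @ vwalk_edges (y # b)"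
    unfolding p_eq by (rule vwalk_edges_append)
  then have "set (vwalk_edges ((x # a) @ [y])) \<subseteq> E" using p by (simp add: path_def)
  moreover have "{y, x} \<in> E" using y(1) by (simp add: nb_def insert_commute)
  moreover have "distinct ((x # a) @ [y])" using p xq q by (auto simp: path_def)
  moreover have "3 \<le> length ((x # a) @ [y])" using a by (cases a) auto
  ultimately have "cyc ((x # a) @ [y])" by (intro cycI) auto
  then show ?thesis by blast
qed

lemma ex_longest_cyc: "\<exists>xs. cyc xs \<and> (\<forall>ys. cyc ys \<longrightarrow> length ys \<le> length xs)"
proof -
  obtain xs where "cyc xs" using ex_cyc by blast
  moreover have "\<forall>ys. cyc ys \<longrightarrow> length ys < Suc (card V)" using cycD(5) by (simp add: less_Suc_eq_le)
  ultimately show ?thesis using ex_has_greatest_nat[of cyc xs length] by blast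
qed

end

section \<open>Independence of the vertices off a longest cycle\<close>

locale longest_cycle = tough_2K2_free +
  fixes C :: "'a list"
  assumes cyc_C: "cyc C" and longest: "cyc ys \<Longrightarrow> length ys \<le> length C"
begin

abbreviation "K \<equiv> set C"
abbreviation "I \<equiv> V - set C"
abbreviation "EC \<equiv> cycle_edges C"

lemma distinct_C: "distinct C" and length_C: "3 \<le> length C" and EC_subset: "EC \<subseteq> E"
  using cyc_C by (simp_all add: cyc_def)

lemma card_K: "card K = length C"
  by (simp add: distinct_C distinct_card)

lemma K_subset: "K \<subseteq> V"
  using cycD cyc_C by blast

lemma finite_EC: "finite EC"
  by (simp add: cycle_edges_def)

lemma deg_EC: "deg EC v = (if v \<in> K then 2 else 0)"
  by (rule deg_cycle_edges[OF distinct_C length_C])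

lemma card_EC: "card EC = card K"
  by (simp add: card_cycle_edges distinct_C length_C card_K)

lemma EC_subset_K: "{x, y} \<in> EC \<Longrightarrow> x \<in> K \<and> y \<in> K"
  using deg_EC[of x] deg_EC[of y] deg_pos[OF finite_EC, of "{x, y}"]
  by (metis insertI1 insert_commute less_irrefl)

lemma EC_edge: "e \<in> EC \<Longrightarrow> \<exists>x y. e = {x, y} \<and> x \<noteq> y \<and> x \<in> K \<and> y \<in> K"
  using EC_subset edge EC_subset_K by (metis subsetD)

lemma cycle_list:
  assumes "{x, y} \<in> EC"
  shows "\<exists>ys. ys \<noteq> [] \<and> hd ys = y \<and> last ys = x \<and> distinct ys \<and> set ys = K \<and> length ys = length C \<and>
    cycle_edges ys = EC"
proof -
  obtain ys where ys: "ys \<noteq> []" "{x, y} = {last ys, hd ys}" "mset ys = mset C" "cycle_edges ys = EC"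
    using cycle_rotate_edge[OF assms] length_C by fastforce
  have ms: "distinct ys" "set ys = K" "length ys = length C"
    using ys(3) distinct_C mset_eq_imp_distinct_iff mset_eq_setD mset_eq_length by blast+
  show ?thesis
  proof (cases "y = hd ys \<and> x = last ys")
    case True
    then show ?thesis using ys ms by blast
  next
    case False
    then have "y = last ys" "x = hd ys" using ys(2) by (auto simp: doubleton_eq_iff)
    moreover have "cycle_edges (rev ys) = EC"
      using ys by (simp add: cycle_edges_eq vwalk_edges_rev hd_rev last_rev insert_commute)
    ultimately show ?thesis
      using ys ms by (intro exI[of _ "rev ys"]) (auto simp: hd_rev last_rev)
  qed
qed

text \<open>Rerouting the cycle edge through \<open>p\<close> would give a longer cycle.\<close>

lemma no_detour:
  assumes "{x, y} \<in> EC" "p \<noteq> []" "distinct p" "set p \<inter> K = {}" "set (vwalk_edges p) \<subseteq> E"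
    "{x, hd p} \<in> E" "{last p, y} \<in> E"
  shows False
proof -
  obtain ys where ys: "ys \<noteq> []" "hd ys = y" "last ys = x" "distinct ys" "set ys = K"
    "length ys = length C" "cycle_edges ys = EC"
    using cycle_list[OF assms(1)] by blast
  have "set (vwalk_edges ys) \<subseteq> E" using ys(1,7) EC_subset by (auto simp: cycle_edges_eq)
  then have "cyc (ys @ p)"
    using assms ys length_C by (intro cycI) (auto simp: vwalk_edges_append2)
  from longest[OF this] show False using ys assms(2) by simp
qed

lemma not_consecutive: "{x, y} \<in> EC \<Longrightarrow> u \<notin> K \<Longrightarrow> {u, x} \<in> E \<Longrightarrow> {u, y} \<in> E \<Longrightarrow> False"
  using no_detour[of x y "[u]"] by (simp add: insert_commute)

lemma no_detour_2:
  "{x, y} \<in> EC \<Longrightarrow> u \<notin> K \<Longrightarrow> v \<notin> K \<Longrightarrow> {u, x} \<in> E \<Longrightarrow> {u, v} \<in> E \<Longrightarrow> {v, y} \<in> E \<Longrightarrow> False"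
  using no_detour[of x y "[u, v]"] edgeD(3)[of u v] by (simp add: insert_commute)

lemma no_detour_3:
  "{x, y} \<in> EC \<Longrightarrow> u \<notin> K \<Longrightarrow> v \<notin> K \<Longrightarrow> w \<notin> K \<Longrightarrow> u \<noteq> w \<Longrightarrow>
    {u, x} \<in> E \<Longrightarrow> {u, v} \<in> E \<Longrightarrow> {v, w} \<in> E \<Longrightarrow> {w, y} \<in> E \<Longrightarrow> False"
  using no_detour[of x y "[u, v, w]"] edgeD(3)[of u v] edgeD(3)[of v w] by (simp add: insert_commute)

text \<open>If \<open>{u, v}\<close> were an edge, then detours and 2K2-freeness would leave every
  cycle edge exactly one end in \<open>A\<close>, so that \<open>A\<close> and \<open>B\<close> have
  equal size. The vertices of \<open>B\<close> then have neighbours in \<open>A\<close> only, and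
  deleting \<open>A\<close> leaves at least \<open>card B + 1\<close> components, too many for
  toughness.\<close>

lemma I_independent:
  assumes u: "u \<in> I" and v: "v \<in> I"
  shows "{u, v} \<notin> E"
proof
  assume uv: "{u, v} \<in> E"
  define A where "A = {k \<in> K. {u, k} \<in> E \<or> {v, k} \<in> E}"
  define B where "B = K - A"
  have uK: "u \<notin> K" and vK: "v \<notin> K" using u v by auto
  have vu: "{v, u} \<in> E" using uv by (simp add: insert_commute)
  have split: "x \<in> A \<longleftrightarrow> y \<in> B" if xy: "{x, y} \<in> EC" for x y
  proof -
    have K: "x \<in> K" "y \<in> K" using EC_subset_K[OF xy] by auto
    have "\<not> (x \<in> A \<and> y \<in> A)"
      using not_consecutive[OF xy uK] not_consecutive[OF xy vK]
        no_detour_2[OF xy uK vK _ uv] no_detour_2[OF xy vK uK _ vu] unfolding A_def by blast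
    moreover have "x \<in> A \<or> y \<in> A"
      using free[OF uv, of x y] xy EC_subset K uK vK unfolding A_def by auto
    ultimately show ?thesis using K unfolding B_def by blast
  qed
  have finA: "finite A" "finite B" by (simp_all add: A_def B_def)
  have "card (e \<inter> A) = 1" if eEC: "e \<in> EC" for e
  proof -
    obtain x y where e: "e = {x, y}" using EC_edge[OF eEC] by blast
    have "e \<inter> A = {x} \<or> e \<inter> A = {y}"
      using split[of x y] EC_subset_K[of x y] eEC e unfolding B_def by blast
    then show ?thesis by auto
  qed
  \<comment> \<open>Counting the cycle edges by their unique end in \<open>A\<close> yields
    \<open>card K = 2 * card A\<close>.\<close>
  then have "(\<Sum>k\<in>A. deg EC k) = card EC"
    using sum_deg[OF finite_EC finA(1)] by simp
  moreover have "(\<Sum>k\<in>A. deg EC k) = 2 * card A"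
    by (simp add: deg_EC A_def)
  moreover have "card K = card A + card B"
    unfolding B_def by (simp add: A_def card_Diff_subset card_mono)
  ultimately have AB: "card A = card B" using card_EC by linarith
  then have B1: "1 \<le> card B" using \<open>card K = card A + card B\<close> card_K length_C by linarith
  \<comment> \<open>The exempt vertex is \<open>u\<close>, which keeps its neighbour
    \<open>v\<close>.\<close>
  have "3 * card (insert u B) \<le> 2 * card A"
  proof (rule tough[where x = u])
    show "A \<subseteq> V" using K_subset by (auto simp: A_def)
    show "insert u B \<subseteq> V - A" using K_subset u by (auto simp: A_def B_def)
    show "2 \<le> card (insert u B)" using B1 finA uK by (simp add: B_def)
    fix w t assume "w \<in> insert u B" "w \<noteq> u" and wt: "{w, t} \<in> E"
    then have w: "w \<in> B" by simp
    then have wuv: "{u, w} \<notin> E" "{v, w} \<notin> E" "w \<in> K" by (auto simp: A_def B_def)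
    have tuv: "t \<noteq> u" "t \<noteq> v" using wt wuv by (auto simp: insert_commute)
    have f: "{u, t} \<in> E \<or> {v, t} \<in> E"
      using free[OF uv wt] tuv wuv uK vK by auto
    have "t \<in> K"
    proof (rule ccontr)
      assume t: "t \<notin> K"
      have "deg EC w = 2" using wuv(3) by (simp add: deg_EC)
      then obtain e where e: "e \<in> EC" "w \<in> e"
        unfolding deg_def by (metis (mono_tags, lifting) Collect_empty_eq card.empty zero_neq_numeral)
      then obtain x where x: "e = {x, w}" using EC_edge by blast
      have xw: "{x, w} \<in> EC" using e x by simp
      have tw: "{t, w} \<in> E" using wt by (simp add: insert_commute)
      \<comment> \<open>Both \<open>x\<close> and \<open>t\<close> are adjacent to \<open>u\<close>
        or \<open>v\<close>, so the cycle edge \<open>{x, w}\<close> can be rerouted through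
        \<open>t\<close> and one or both of \<open>u\<close>, \<open>v\<close>.\<close>
      have "{u, x} \<in> E \<or> {v, x} \<in> E" using split[OF xw] w by (simp add: A_def)
      then show False
        using f no_detour_2[OF xw uK t _ _ tw] no_detour_2[OF xw vK t _ _ tw]
          no_detour_3[OF xw uK vK t _ _ uv _ tw] no_detour_3[OF xw vK uK t _ _ vu _ tw] tuv by metis
    qed
    then show "t \<in> A" using f by (simp add: A_def)
  qed
  then show False using AB finA uK by (simp add: B_def)
qed

section \<open>Attachments on the cycle and a lower bound on its length\<close>

lemma nb_I:
  assumes "v \<in> I"
  shows "nb v \<subseteq> K"
  using I_independent[OF assms] edgeD by (fastforce simp: nb_def)

lemma EC_nb:
  assumes "k \<in> K"
  shows "\<exists>x y. x \<noteq> y \<and> {z. {k, z} \<in> EC} = {x, y}"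
proof -
  have "{e \<in> EC. k \<in> e} = (\<lambda>z. {k, z}) ` {z. {k, z} \<in> EC}"
    using EC_edge by (fastforce simp: insert_commute)
  moreover have "inj_on (\<lambda>z. {k, z}) {z. {k, z} \<in> EC}"
    by (auto simp: inj_on_def doubleton_eq_iff)
  ultimately have "card {z. {k, z} \<in> EC} = 2"
    using deg_EC[of k] assms by (simp add: deg_def card_image)
  then show ?thesis unfolding card_2_iff by blast
qed

text \<open>Two consecutive cycle vertices are never both adjacent to \<open>v\<close>, so some
  vertex is not, and the neighbourhood of \<open>v\<close> is a separator.\<close>

lemma card_nb_I:
  assumes v: "v \<in> I"
  shows "3 \<le> card (nb v)"
proof -
  have "{last C, hd C} \<in> EC" using length_C by (subst cycle_edges_eq) auto
  then obtain k where "k \<in> K" "{v, k} \<notin> E"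
    using not_consecutive[of "last C" "hd C" v] v EC_subset_K by blast
  then show ?thesis using card_nb_ge_3[of v k] v K_subset by blast
qed

text \<open>Each neighbour of \<open>v\<close> lies on two cycle edges, and no cycle edge contains
  two of them.\<close>

lemma two_card_nb_le:
  assumes v: "v \<in> I"
  shows "2 * card (nb v) \<le> card K"
proof -
  have "card (e \<inter> nb v) \<le> 1" if "e \<in> EC" for e
  proof -
    obtain x y where e: "e = {x, y}" using EC_edge[OF \<open>e \<in> EC\<close>] by blast
    have "e \<inter> nb v \<subseteq> {x} \<or> e \<inter> nb v \<subseteq> {y}"
      using not_consecutive[of x y v] that e v by (auto simp: nb_def)
    then show ?thesis using card_mono[of "{x}"] card_mono[of "{y}"] by fastforce
  qed
  then have "(\<Sum>k\<in>nb v. deg EC k) \<le> card EC"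
    using sum_deg[OF finite_EC finite_nb, of v] sum_bounded_above[of EC "\<lambda>e. card (e \<inter> nb v)" 1] by simp
  moreover have "(\<Sum>k\<in>nb v. deg EC k) = (\<Sum>k\<in>nb v. 2)"
    using nb_I[OF v] by (intro sum.cong) (auto simp: deg_EC)
  ultimately show ?thesis using card_EC by simp
qed

lemma cyc_longer: "cyc ys \<Longrightarrow> length C < length ys \<Longrightarrow> False"
  using longest by fastforce

text \<open>The vertices \<open>b\<close>, \<open>d\<close>, \<open>f\<close> are pairwise
  nonadjacent and have no neighbours off the cycle, since otherwise a cycle of length 7 or 8 would
  arise. So deleting \<open>a\<close>, \<open>c\<close>, \<open>e\<close> isolates the four vertices
  \<open>b\<close>, \<open>d\<close>, \<open>f\<close>, \<open>v\<close>, against toughness.\<close>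

lemma hexagon:
  assumes C: "{a, b} \<in> E" "{b, c} \<in> E" "{c, d} \<in> E" "{d, e} \<in> E" "{e, f} \<in> E" "{f, a} \<in> E"
    and K: "K = {a, b, c, d, e, f}" and dist: "distinct [a, b, c, d, e, f]"
    and EC: "EC = {{a, b}, {b, c}, {c, d}, {d, e}, {e, f}, {f, a}}"
    and v: "v \<in> I" and nbv: "{a, c, e} \<subseteq> nb v"
  shows False
proof -
  have len: "length C = 6" using K dist card_K by simp
  have vK: "v \<notin> {a, b, c, d, e, f}" using v K by simp
  have va: "{v, a} \<in> E" and vc: "{v, c} \<in> E" and ve: "{v, e} \<in> E" using nbv by (auto simp: nb_def)
  note sym = insert_commute[of _ _ "{}"]
  have bd: "{b, d} \<notin> E"
    using cyc_longer[of "[a, v, c, b, d, e, f]"] cycI[of "[a, v, c, b, d, e, f]"] C va vc dist vK len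
    by (auto simp: sym)
  have df: "{d, f} \<notin> E"
    using cyc_longer[of "[c, v, e, d, f, a, b]"] cycI[of "[c, v, e, d, f, a, b]"] C vc ve dist vK len
    by (auto simp: sym)
  have fb: "{f, b} \<notin> E"
    using cyc_longer[of "[e, v, a, f, b, c, d]"] cycI[of "[e, v, a, f, b, c, d]"] C va ve dist vK len
    by (auto simp: sym)
  have bdf: "w \<notin> I" if q: "q \<in> {b, d, f}" "{q, w} \<in> E" for q w
  proof
    assume w: "w \<in> I"
    then have wK: "w \<notin> K" by simp
    have sub: "nb w \<subseteq> {a, b, c, d, e, f}" using nb_I[OF w] K by simp
    have nc: "\<not> (x \<in> nb w \<and> y \<in> nb w)" if "{x, y} \<in> EC" for x y
      using not_consecutive[OF that wK] by (auto simp: nb_def)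
    have n: "\<not> (a \<in> nb w \<and> b \<in> nb w)" "\<not> (b \<in> nb w \<and> c \<in> nb w)" "\<not> (c \<in> nb w \<and> d \<in> nb w)"
      "\<not> (d \<in> nb w \<and> e \<in> nb w)" "\<not> (e \<in> nb w \<and> f \<in> nb w)" "\<not> (f \<in> nb w \<and> a \<in> nb w)"
      by (rule nc; simp add: EC)+
    have qw: "q \<in> nb w" using q(2) by (simp add: nb_def sym)
    have small: "\<not> nb w \<subseteq> {x, y}" for x y
      using card_nb_I[OF w] card_mono[of "{x, y}" "nb w"] card_insert_le_m1[of 2 "{y}" x] by fastforce
    \<comment> \<open>With at least three neighbours, no two of them consecutive, \<open>w\<close>
      is attached to every second vertex; as \<open>q\<close> is one of them, these are
      \<open>b\<close>, \<open>d\<close>, \<open>f\<close>.\<close>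
    have "b \<in> nb w \<and> d \<in> nb w"
      using q(1) qw n sub small[of b e] small[of d f] small[of d a] small[of f b] small[of f c] small[of b d]
      by blast
    then have "{b, w} \<in> E" "{w, d} \<in> E" by (simp_all add: nb_def sym)
    moreover have "w \<noteq> v" using \<open>b \<in> nb w \<and> d \<in> nb w\<close> n nbv by blast
    ultimately show False
      using cyc_longer[of "[a, v, c, b, w, d, e, f]"] cycI[of "[a, v, c, b, w, d, e, f]"]
        C va vc dist vK wK K len by (auto simp: sym)
  qed
  have vb: "{v, x} \<notin> E" if "x \<in> {b, d, f}" for x
  proof -
    have "v \<notin> K" using v by simp
    then show ?thesis
      using that not_consecutive[of a b v] not_consecutive[of c d v] not_consecutive[of e f v] va vc ve
      by (auto simp: EC)
  qed
  have c4: "card {b, d, f, v} = 4" using dist vK by (auto simp: card_insert_if)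
  have "3 * card {b, d, f, v} \<le> 2 * card {a, c, e}"
  proof (rule tough[where x = undefined])
    show "{a, c, e} \<subseteq> V" using K_subset K by auto
    show "{b, d, f, v} \<subseteq> V - {a, c, e}" using K_subset K dist v by auto
    show "2 \<le> card {b, d, f, v}" using c4 by simp
    fix x y assume x: "x \<in> {b, d, f, v}" and xy: "{x, y} \<in> E"
    show "y \<in> {a, c, e}"
    proof (cases "x = v")
      case True
      then show ?thesis using nb_I[OF v] K vb xy by (auto simp: nb_def)
    next
      case False
      then have x: "x \<in> {b, d, f}" using x by simp
      then have "y \<in> K" using bdf[OF x xy] edgeD[OF xy] by simp
      then show ?thesis using x xy bd df fb edgeD(3)[OF xy] K by (auto simp: sym)
    qed
  qed
  then show False using c4 dist by simp
qed

text \<open>By \<open>card_nb_I\<close> and \<open>two_card_nb_le\<close> the length is at least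
  six, and in case of equality \<open>v\<close> is attached to alternate vertices of a hexagon. The
  bound excludes the short cycles that appear when three loose vertices are repaired.\<close>

lemma card_K_ge_7:
  assumes v: "v \<in> I"
  shows "7 \<le> card K"
proof (rule ccontr)
  assume "\<not> 7 \<le> card K"
  then have n6: "card K = 6" using two_card_nb_le[OF v] card_nb_I[OF v] by linarith
  then obtain a b c d e f where C: "C = [a, b, c, d, e, f]"
    by (auto simp: card_K length_Suc_conv numeral_eq_Suc)
  have EC: "EC = {{a, b}, {b, c}, {c, d}, {d, e}, {e, f}, {f, a}}"
    by (auto simp: C cycle_edges_def)
  have E: "{a, b} \<in> E" "{b, c} \<in> E" "{c, d} \<in> E" "{d, e} \<in> E" "{e, f} \<in> E" "{f, a} \<in> E"
    using EC_subset EC by auto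
  have vK: "v \<notin> K" using v by simp
  have nc: "\<not> (x \<in> nb v \<and> y \<in> nb v)" if "{x, y} \<in> EC" for x y
    using not_consecutive[OF that vK] by (auto simp: nb_def)
  have n: "\<not> (a \<in> nb v \<and> b \<in> nb v)" "\<not> (b \<in> nb v \<and> c \<in> nb v)" "\<not> (c \<in> nb v \<and> d \<in> nb v)"
    "\<not> (d \<in> nb v \<and> e \<in> nb v)" "\<not> (e \<in> nb v \<and> f \<in> nb v)" "\<not> (f \<in> nb v \<and> a \<in> nb v)"
    by (rule nc; simp add: EC)+
  have small: "\<not> nb v \<subseteq> {x, y}" for x y
    using card_nb_I[OF v] card_mono[of "{x, y}" "nb v"] card_insert_le_m1[of 2 "{y}" x] by fastforce
  have sub: "nb v \<subseteq> {a, b, c, d, e, f}" using nb_I[OF v] C by simp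
  have "{a, c, e} \<subseteq> nb v \<or> {b, d, f} \<subseteq> nb v"
    using n sub small[of a c] small[of a d] small[of a e] small[of b d] small[of b e] small[of b f]
      small[of c e] small[of c f] small[of d f] by blast
  then show False
    using hexagon[of a b c d e f v] hexagon[of b c d e f a v] E EC C v distinct_C
    by (auto simp: insert_commute)
qed

text \<open>The witnesses are the successors of \<open>t\<close> and \<open>t'\<close> in one
  orientation of the cycle. If they were adjacent, reversing the segment between \<open>t\<close>
  and \<open>t'\<close> would make room for \<open>w\<close> and give a longer cycle.\<close>

lemma crossing_missing:
  assumes w: "w \<in> I" and t: "{w, t} \<in> E" and t': "{w, t'} \<in> E" and ne: "t \<noteq> t'"
  shows "\<exists>a a'. {t, a} \<in> EC \<and> {t', a'} \<in> EC \<and> a \<noteq> a' \<and> {a, a'} \<notin> E"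
proof -
  have wK: "w \<notin> K" using w by simp
  have K: "t \<in> K" "t' \<in> K" using nb_I[OF w] t t' by (auto simp: nb_def)
  obtain ys where ys: "ys \<noteq> []" "hd ys = t" "mset ys = mset C" "cycle_edges ys = EC"
    using cycle_rotate[OF K(1)] by blast
  have ms: "distinct ys" "set ys = K" "length ys = length C"
    using ys(3) distinct_C mset_eq_imp_distinct_iff mset_eq_setD mset_eq_length by blast+
  obtain r where r: "ys = t # r" using ys(1,2) by (cases ys) auto
  then have "t' \<in> set r" using ms(2) K(2) ne by auto
  then obtain p q where pq: "r = p @ t' # q" by (meson split_list)
  have ys_eq: "ys = t # p @ t' # q" using r pq by simp
  have nEC: "{t, t'} \<notin> EC" using not_consecutive[OF _ wK t t'] by blast
  have EC_eq: "EC = insert {last ys, t} (set (vwalk_edges ys))"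
    using cycle_edges_eq[OF ys(1)] ys(2,4) by simp
  have p: "p \<noteq> []"
  proof
    assume "p = []"
    then have "{t, t'} \<in> EC" unfolding EC_eq using ys_eq by simp
    then show False using nEC by simp
  qed
  have q: "q \<noteq> []"
  proof
    assume "q = []"
    then have "{t', t} \<in> EC" unfolding EC_eq using ys_eq by simp
    then show False using nEC by (simp add: insert_commute)
  qed
  have edges: "set (vwalk_edges ys) =
      {{t, hd p}, {last p, t'}, {t', hd q}} \<union> set (vwalk_edges p) \<union> set (vwalk_edges q)"
    unfolding ys_eq using p q by (auto simp: vwalk_edges_Cons vwalk_edges_append2)
  have "{hd p, hd q} \<notin> E"
  proof
    assume pq: "{hd p, hd q} \<in> E"
    have "last ys = last q" using ys_eq q by simp
    then have subE: "{{t, hd p}, {last p, t'}, {t', hd q}} \<union> set (vwalk_edges p) \<union> set (vwalk_edges q) \<subseteq> E"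
      and l: "{last q, t} \<in> E"
      using EC_subset EC_eq edges by auto
    have "cyc (t # w # t' # rev p @ q)"
    proof (rule cycI)
      show "distinct (t # w # t' # rev p @ q)" using ms(1,2) wK ys_eq by auto
      show "3 \<le> length (t # w # t' # rev p @ q)" by simp
      show "{last (t # w # t' # rev p @ q), hd (t # w # t' # rev p @ q)} \<in> E" using l q by simp
      show "set (vwalk_edges (t # w # t' # rev p @ q)) \<subseteq> E"
        using p q subE pq t t'
        by (auto simp: vwalk_edges_Cons vwalk_edges_append2 vwalk_edges_rev hd_rev last_rev insert_commute)
    qed
    from longest[OF this] show False using ms(3) ys_eq by simp
  qed
  moreover have "{t, hd p} \<in> EC" "{t', hd q} \<in> EC" unfolding EC_eq edges by auto
  moreover have "hd p \<noteq> hd q"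
    using ms(1) ys_eq p q by (metis disjoint_iff distinct.simps(2) distinct_append hd_in_set list.set_intros(2))
  ultimately show ?thesis by blast
qed

lemma EC_three_nb:
  assumes "{k, x} \<in> EC" "{k, y} \<in> EC" "{k, z} \<in> EC" "x \<noteq> y"
  shows "z = x \<or> z = y"
proof -
  have "k \<in> K" using EC_subset_K[OF assms(1)] by simp
  then obtain a b where ab: "{z. {k, z} \<in> EC} = {a, b}" using EC_nb by blast
  have "x \<in> {a, b}" "y \<in> {a, b}" "z \<in> {a, b}" unfolding ab[symmetric] using assms by simp_all
  then show ?thesis using assms(4) by auto
qed

text \<open>A cycle vertex has only two cycle neighbours, so such an \<open>X\<close> cannot be left
  along the cycle. This serves to bound the length of the cycle by the size of a small
  configuration.\<close>

lemma EC_closed: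
  assumes "x \<in> X" "x \<in> K"
    and cl: "\<And>x. x \<in> X \<Longrightarrow> \<exists>y\<in>X. \<exists>z\<in>X. y \<noteq> z \<and> {x, y} \<in> EC \<and> {x, z} \<in> EC"
  shows "K \<subseteq> X"
proof (rule linkedD[OF linked_cycle_remove_edge[OF distinct_C length_C, of "{}"]])
  show "X \<inter> K \<noteq> {}" using assms by blast
  fix e assume "e \<in> EC - {{}}" "e \<inter> X \<noteq> {}"
  then obtain x where x: "x \<in> e" "x \<in> X" and e: "e \<in> EC" by blast
  then obtain w where w: "e = {x, w}" using EC_edge by (metis insertE insert_commute singletonD)
  obtain y z where "y \<in> X" "z \<in> X" "y \<noteq> z" "{x, y} \<in> EC" "{x, z} \<in> EC" using cl[OF x(2)] by blast
  then have "w = y \<or> w = z" using EC_three_nb e w by blast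
  then show "e \<subseteq> X" using w x \<open>y \<in> X\<close> \<open>z \<in> X\<close> by auto
qed

section \<open>Attaching the remaining vertices to the cycle\<close>

text \<open>
  The vertex \<open>s\<close> is given degree three on purpose: it provides an odd vertex off the cycle with
  which the last odd vertex on the cycle can be paired.
\<close>

definition demand :: "'a \<Rightarrow> 'a \<Rightarrow> nat" where
  "demand s v = (if v = s then 3 else 2)"

text \<open>The demand exceeds \<open>2 * card X\<close> by at most one. Vertices with two
  neighbours outside \<open>Y\<close> pay for themselves, those in \<open>X0\<close> and
  \<open>X1\<close> fall short by two and one. So
  \<open>2 * card X0 + card X1 + 1 \<le> 2 * card Y\<close> suffices, which comes from toughness,
  with \<open>Y\<close> and neighbours of \<open>X1\<close> as separator.\<close>

lemma demand_hall:
  assumes X: "X \<subseteq> I" and Y: "Y \<subseteq> K"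
  shows "(\<Sum>v\<in>X. demand s v) \<le> 2 * card Y + (\<Sum>v\<in>X. card (nb v - Y))"
proof (cases "X = {}")
  case False
  have finX: "finite X" using X finite_V by (meson finite_Diff finite_subset)
  have finY: "finite Y" using Y by (meson List.finite_set finite_subset)
  define d where "d v = card (nb v - Y)" for v
  define X0 where "X0 = {v \<in> X. d v = 0}"
  define X1 where "X1 = {v \<in> X. d v = 1}"
  have fin01: "finite X0" "finite X1" using finX by (simp_all add: X0_def X1_def)
  have card01: "card (X0 \<union> X1) = card X0 + card X1"
    using fin01 by (intro card_Un_disjoint) (auto simp: X0_def X1_def)
  have "(\<Sum>v\<in>X. demand s v) = (\<Sum>v\<in>X. 2) + (\<Sum>v\<in>X. of_bool (v = s))"
    unfolding sum.distrib[symmetric] by (intro sum.cong) (auto simp: demand_def)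
  also have "(\<Sum>v\<in>X. of_bool (v = s)) \<le> (1::nat)"
    using finX by (simp add: card_le_Suc0_iff_eq)
  finally have dem: "(\<Sum>v\<in>X. demand s v) \<le> 2 * card X + 1" by simp
  have "(\<Sum>v\<in>X. 2) \<le> (\<Sum>v\<in>X. d v + of_bool (d v = 1) + 2 * of_bool (d v = 0))"
    by (intro sum_mono) auto
  also have "\<dots> = (\<Sum>v\<in>X. d v) + card X1 + 2 * card X0"
    using finX by (simp add: sum.distrib sum_distrib_left[symmetric] X0_def X1_def Int_def)
  finally have low: "2 * card X \<le> (\<Sum>v\<in>X. d v) + card X1 + 2 * card X0" by simp
  have nbd: "3 \<le> card Y + d v" if "v \<in> X" for v
  proof -
    have "card (nb v) \<le> card Y + card (nb v - Y)"
      using card_mono[of "Y \<union> (nb v - Y)" "nb v"] finY finite_nb[of v] card_Un_le[of Y "nb v - Y"] by fastforce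
    then show ?thesis using card_nb_I[of v] that X unfolding d_def by fastforce
  qed
  have "2 * card X + 1 \<le> 2 * card Y + (\<Sum>v\<in>X. d v)"
  proof (cases "X0 \<union> X1 = {}")
    case True
    show ?thesis
    proof (cases "Y = {}")
      case True
      \<comment> \<open>Every vertex has three neighbours outside the empty \<open>Y\<close>, one
        more than the usual demand; this pays for the extra unit at \<open>s\<close>.\<close>
      then have "(\<Sum>v\<in>X. 3) \<le> (\<Sum>v\<in>X. d v)" using nbd by (intro sum_mono) auto
      moreover have "1 \<le> card X" using \<open>X \<noteq> {}\<close> finX by (simp add: Suc_leI card_gt_0_iff)
      ultimately show ?thesis by simp
    next
      case False
      then have "1 \<le> card Y" using finY by (simp add: Suc_leI card_gt_0_iff)
      then show ?thesis using low \<open>X0 \<union> X1 = {}\<close> by simp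
    qed
  next
    case ne: False
    have "2 * card X0 + card X1 + 1 \<le> 2 * card Y"
    proof (cases "card (X0 \<union> X1) \<ge> 2")
      case False
      \<comment> \<open>Toughness needs two components, so a single vertex is handled by its
        degree.\<close>
      then have c1: "card (X0 \<union> X1) = 1" using ne fin01
        by (metis One_nat_def Suc_leI card_gt_0_iff finite_UnI le_antisym not_less_eq_eq numeral_2_eq_2)
      obtain v where v: "v \<in> X0 \<union> X1" using ne by blast
      show ?thesis
      proof (cases "v \<in> X0")
        case True
        then have "3 \<le> card Y" using nbd[of v] by (simp add: X0_def)
        then show ?thesis using c1 card01 by linarith
      next
        case False
        then have "v \<in> X1" using v by blast
        then have "2 \<le> card Y" and "0 < card X1"
          using nbd[of v] fin01 by (force simp: X1_def, force simp: card_gt_0_iff)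
        then show ?thesis using c1 card01 by linarith
      qed
    next
      case True
      show ?thesis
      proof (cases "X1 = {}")
        case True
        have "3 * card X0 \<le> 2 * card Y"
        proof (rule tough[where x = undefined])
          show "Y \<subseteq> V" "X0 \<subseteq> V - Y" using X Y K_subset by (auto simp: X0_def)
          show "2 \<le> card X0" using \<open>card (X0 \<union> X1) \<ge> 2\<close> True by simp
          show "w \<in> Y" if "v \<in> X0" "{v, w} \<in> E" for v w
            using that finite_nb[of v] by (auto simp: X0_def d_def nb_def)
        qed
        then show ?thesis using True \<open>card (X0 \<union> X1) \<ge> 2\<close> by simp
      next
        case False
        then obtain z where z: "z \<in> X1" by blast
        text \<open>Keeping the single neighbour of \<open>z\<close> outside \<open>Y\<close> saves a vertex of the separator.\<close>
        define S where "S = Y \<union> (\<Union>v\<in>X1 - {z}. nb v - Y)"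
        have "card (\<Union>v\<in>X1 - {z}. nb v - Y) \<le> (\<Sum>v\<in>X1 - {z}. card (nb v - Y))"
          using fin01 by (intro card_UN_le) simp
        also have "\<dots> = (\<Sum>v\<in>X1 - {z}. 1)"
          by (intro sum.cong) (auto simp: X1_def d_def)
        also have "\<dots> = card X1 - 1" using z by (simp add: card_Diff_singleton)
        finally have S: "card S \<le> card Y + (card X1 - 1)"
          unfolding S_def using card_Un_le[of Y "\<Union>v\<in>X1 - {z}. nb v - Y"] by linarith
        have "3 * card (X0 \<union> X1) \<le> 2 * card S"
        proof (rule tough[where x = z])
          have nbK: "nb v \<subseteq> K" if "v \<in> X1" for v using that X nb_I by (auto simp: X1_def)
          then have "S \<subseteq> K" using Y unfolding S_def by blast
          then show "S \<subseteq> V" "X0 \<union> X1 \<subseteq> V - S" using X K_subset by (auto simp: X0_def X1_def)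
          show "2 \<le> card (X0 \<union> X1)" by fact
          show "w \<in> S" if "v \<in> X0 \<union> X1" "v \<noteq> z" "{v, w} \<in> E" for v w
          proof (cases "v \<in> X0")
            case True
            then show ?thesis using that finite_nb[of v] by (auto simp: X0_def d_def nb_def S_def)
          next
            case False
            then show ?thesis using that by (auto simp: S_def nb_def)
          qed
        qed
        moreover have "0 < card X1" using z fin01 by (force simp: card_gt_0_iff)
        \<comment> \<open>The inequalities combine to
          \<open>3 * card X0 + card X1 + 2 \<le> 2 * card Y\<close>; the saved vertex of the
          separator is what gives the constant.\<close>
        ultimately show ?thesis using S card01 by linarith
      qed
    qed
    then show ?thesis using low by linarith
  qed
  then show ?thesis using dem unfolding d_def by linarith
qed simp

definition attachment :: "'a \<Rightarrow> 'a set set \<Rightarrow> bool" where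
  "attachment s R \<longleftrightarrow> R \<subseteq> E - EC \<and> (\<forall>v\<in>I. deg R v = demand s v) \<and> (\<forall>k\<in>K. deg R k \<le> 2) \<and>
    (\<forall>e\<in>R. \<forall>k\<in>e. k \<in> K \<longrightarrow> deg R k = 1 \<longrightarrow> \<not> e \<subseteq> K)"

definition loose :: "'a set set \<Rightarrow> 'a set" where
  "loose R = {k \<in> K. deg R k = 1}"

lemma attachment_exists: "\<exists>R. attachment s R"
proof -
  have "\<exists>M. (\<forall>v\<in>I. M v \<subseteq> nb v \<and> card (M v) = demand s v) \<and> (\<forall>k. card {v \<in> I. k \<in> M v} \<le> 2)"
    using demand_hall nb_I finite_V by (intro capacitated_matching[where K = K]) auto
  then obtain M where M: "\<And>v. v \<in> I \<Longrightarrow> M v \<subseteq> nb v" "\<And>v. v \<in> I \<Longrightarrow> card (M v) = demand s v"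
    and cap: "\<And>k. card {v \<in> I. k \<in> M v} \<le> 2" by blast
  define R where "R = {{v, k} | v k. v \<in> I \<and> k \<in> M v}"
  have MK: "k \<in> K" if "v \<in> I" "k \<in> M v" for v k using M(1) nb_I that by blast
  have "R \<subseteq> E - EC"
  proof
    fix e assume "e \<in> R"
    then obtain v k where e: "e = {v, k}" "v \<in> I" "k \<in> M v" by (auto simp: R_def)
    then have "e \<in> E" using M(1) by (auto simp: nb_def)
    moreover have "e \<notin> EC" using EC_subset_K[of v k] e by auto
    ultimately show "e \<in> E - EC" by simp
  qed
  moreover have "deg R v = demand s v" if v: "v \<in> I" for v
  proof -
    have "{e \<in> R. v \<in> e} = (\<lambda>k. {v, k}) ` M v"
      using v MK by (fastforce simp: R_def)
    moreover have "inj_on (\<lambda>k. {v, k}) (M v)" by (auto simp: inj_on_def doubleton_eq_iff)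
    ultimately show ?thesis using M(2)[OF v] by (simp add: deg_def card_image)
  qed
  moreover have "deg R k \<le> 2" if k: "k \<in> K" for k
  proof -
    have "{e \<in> R. k \<in> e} = (\<lambda>v. {v, k}) ` {v \<in> I. k \<in> M v}"
      using k by (fastforce simp: R_def)
    moreover have "inj_on (\<lambda>v. {v, k}) {v \<in> I. k \<in> M v}" by (auto simp: inj_on_def doubleton_eq_iff)
    ultimately show ?thesis using cap[of k] by (simp add: deg_def card_image)
  qed
  moreover have "\<not> e \<subseteq> K" if "e \<in> R" for e using that by (auto simp: R_def)
  ultimately have "attachment s R" by (auto simp: attachment_def)
  then show ?thesis by blast
qed

section \<open>Loose vertices: parity and reduction\<close>

lemma finite_attachment: "attachment s R \<Longrightarrow> finite R"
  using finite_E finite_subset unfolding attachment_def by blast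

lemma loose_partner:
  assumes R: "attachment s R" and t: "t \<in> loose R"
  obtains p where "p \<in> I" "{t, p} \<in> R" "\<And>x. {t, x} \<in> R \<Longrightarrow> x = p"
proof -
  have t: "t \<in> K" "deg R t = 1" using t by (auto simp: loose_def)
  then obtain e where e: "e \<in> R" "t \<in> e" unfolding deg_def
    by (metis (mono_tags, lifting) Collect_empty_eq card.empty zero_neq_one)
  then have eE: "e \<in> E" and nK: "\<not> e \<subseteq> K" using R t unfolding attachment_def by blast+
  obtain p where p: "e = {t, p}" using edge[OF eE] e(2) by fastforce
  have "p \<in> V" "p \<notin> K" using edgeD[of t p] eE p nK t by auto
  moreover have "x = p" if "{t, x} \<in> R" for x
    using deg_1_unique[OF t(2) e that] p by (auto simp: doubleton_eq_iff)
  ultimately show ?thesis using that[of p] e p by blast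
qed

text \<open>Handshake lemma: the vertices of odd degree in \<open>R\<close> are \<open>s\<close> and
  the loose ones.\<close>

lemma odd_loose:
  assumes R: "attachment s R" and s: "s \<in> I"
  shows "odd (card (loose R))"
proof -
  have finR: "finite R" by (rule finite_attachment[OF R])
  have "(\<Sum>v\<in>V. deg R v) = (\<Sum>e\<in>R. card (e \<inter> V))" by (rule sum_deg[OF finR finite_V])
  also have "\<dots> = (\<Sum>e\<in>R. 2)"
  proof (intro sum.cong refl)
    fix e assume "e \<in> R"
    then have "e \<in> E" using R unfolding attachment_def by blast
    from edge[OF this] obtain u v where "e = {u, v}" "u \<noteq> v" "u \<in> V" "v \<in> V" by blast
    then show "card (e \<inter> V) = 2" by simp
  qed
  finally have "even (\<Sum>v\<in>V. deg R v)" by simp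
  then have ev: "even (card {v \<in> V. odd (deg R v)})" using even_sum_iff[OF finite_V] by blast
  have degK: "odd (deg R k) \<longleftrightarrow> deg R k = 1" if "k \<in> K" for k
  proof -
    have "deg R k \<in> {0, 1, 2}" using R that unfolding attachment_def by force
    then show ?thesis by auto
  qed
  have degI: "odd (deg R v) \<longleftrightarrow> v = s" if "v \<in> I" for v
    using R that unfolding attachment_def by (simp add: demand_def)
  have "{v \<in> V. odd (deg R v)} = insert s (loose R)"
    using degK degI s K_subset unfolding loose_def by auto
  moreover have "s \<notin> loose R" "finite (loose R)" using s by (auto simp: loose_def)
  ultimately show ?thesis using ev by simp
qed

text \<open>Add \<open>{t, t'}\<close>, which is not in \<open>R\<close> because the
  \<open>R\<close>-edge at a loose vertex leaves \<open>K\<close>; both ends reach degree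
  two.\<close>

lemma attachment_join:
  assumes R: "attachment s R" and t: "t \<in> loose R" and t': "t' \<in> loose R"
    and tt': "{t, t'} \<in> E" "{t, t'} \<notin> EC"
  shows "\<exists>R'. attachment s R' \<and> loose R' = loose R - {t, t'}"
proof -
  have ne: "t \<noteq> t'" using edgeD[OF tt'(1)] by simp
  have K: "t \<in> K" "t' \<in> K" and d1: "deg R t = 1" "deg R t' = 1" using t t' by (auto simp: loose_def)
  have "{t, t'} \<notin> R" using R K d1 unfolding attachment_def by (metis insertI1 insert_subset empty_subsetI)
  then have dg: "deg (insert {t, t'} R) v = deg R v + of_bool (v \<in> {t, t'})" for v
    using deg_insert[OF finite_attachment[OF R]] by blast
  have "attachment s (insert {t, t'} R)"
    using R K d1 tt' unfolding attachment_def by (auto simp: dg)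
  moreover have "loose (insert {t, t'} R) = loose R - {t, t'}"
    using d1 by (auto simp: loose_def dg)
  ultimately show ?thesis by blast
qed

text \<open>Replacing \<open>{t', p'}\<close> by \<open>{t, p'}\<close> keeps the degree of
  \<open>p'\<close> and turns the degrees of \<open>t\<close> and \<open>t'\<close> into 2 and
  0.\<close>

lemma attachment_switch:
  assumes R: "attachment s R" and t: "t \<in> loose R" and t': "t' \<in> loose R" and ne: "t \<noteq> t'"
    and p': "p' \<in> I" "{t', p'} \<in> R" and tp': "{t, p'} \<in> E" "{t, p'} \<notin> R"
  shows "\<exists>R'. attachment s R' \<and> loose R' = loose R - {t, t'}"
proof -
  have K: "t \<in> K" "t' \<in> K" and d1: "deg R t = 1" "deg R t' = 1" using t t' by (auto simp: loose_def)
  have p'K: "p' \<notin> K" "p' \<noteq> t" "p' \<noteq> t'" using p' K by auto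
  define R' where "R' = (R - {{t', p'}}) \<union> {{t, p'}}"
  have tog: "deg R' v + deg {{t', p'}} v = deg R v + deg {{t, p'}} v" for v
    unfolding R'_def using finite_attachment[OF R] p' tp' by (intro deg_toggle) auto
  have dg: "deg R' v + of_bool (v \<in> {t', p'}) = deg R v + of_bool (v \<in> {t, p'})" for v
    using tog[of v] unfolding deg_single .
  have dt: "deg R' t = 2" "deg R' t' = 0" using dg[of t] dg[of t'] d1 ne p'K by auto
  have dv: "deg R' v = deg R v" if "v \<noteq> t" "v \<noteq> t'" for v using dg[of v] that by (cases "v = p'") auto
  have tp'EC: "{t, p'} \<notin> EC" using EC_subset_K[of t p'] p'K by blast
  have "attachment s R'"
    unfolding attachment_def
  proof (intro conjI ballI impI)
    show "R' \<subseteq> E - EC" using R tp' tp'EC unfolding R'_def attachment_def by auto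
    show "deg R' v = demand s v" if "v \<in> I" for v
      using R that dv[of v] K unfolding attachment_def by auto
    show "deg R' k \<le> 2" if "k \<in> K" for k
      using R that dv[of k] dt unfolding attachment_def by (cases "k = t \<or> k = t'") auto
    show "\<not> e \<subseteq> K" if e: "e \<in> R'" "k \<in> e" "k \<in> K" "deg R' k = 1" for e k
    proof (cases "e = {t, p'}")
      case True
      then show ?thesis using p'K by auto
    next
      case False
      then have "e \<in> R" using e(1) by (auto simp: R'_def)
      moreover have "deg R k = 1" using e dt dv[of k] by (cases "k = t \<or> k = t'") auto
      ultimately show ?thesis using R e unfolding attachment_def by blast
    qed
  qed
  moreover have "loose R' = loose R - {t, t'}"
  proof (rule set_eqI)
    show "v \<in> loose R' \<longleftrightarrow> v \<in> loose R - {t, t'}" for v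
      using dt dv[of v] by (cases "v = t \<or> v = t'") (auto simp: loose_def)
  qed
  ultimately show ?thesis by blast
qed

text \<open>Some edge connects \<open>{t, p}\<close> with \<open>{t', p'}\<close>, and it is not
  \<open>{p, p'}\<close> as \<open>I\<close> is independent. Each of the other three allows joining
  or switching; the cross edges are not in \<open>R\<close>, since a loose vertex has only one
  \<open>R\<close>-edge.\<close>

lemma attachment_reduce:
  assumes R: "attachment s R" and t: "t \<in> loose R" and t': "t' \<in> loose R" and ne: "t \<noteq> t'"
    and p: "p \<in> I" "{t, p} \<in> R" and p': "p' \<in> I" "{t', p'} \<in> R" and pp': "p \<noteq> p'"
    and tt': "{t, t'} \<notin> EC"
  shows "\<exists>R'. attachment s R' \<and> loose R' = loose R - {t, t'}"
proof -
  have RE: "R \<subseteq> E" using R unfolding attachment_def by blast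
  have K: "t \<in> K" "t' \<in> K" and d1: "deg R t = 1" "deg R t' = 1" using t t' by (auto simp: loose_def)
  have n: "{t, p'} \<notin> R" "{t', p} \<notin> R"
    using deg_1_unique[OF d1(1) p(2), of "{t, p'}"] deg_1_unique[OF d1(2) p'(2), of "{t', p}"] pp'
    by (auto simp: doubleton_eq_iff)
  have "{t, t'} \<in> E \<or> {t, p'} \<in> E \<or> {p, t'} \<in> E \<or> {p, p'} \<in> E"
    using p p' RE ne pp' K by (intro free) auto
  then consider "{t, t'} \<in> E" | "{t, p'} \<in> E" | "{t', p} \<in> E"
    using I_independent[OF p(1) p'(1)] by (auto simp: insert_commute)
  then show ?thesis
  proof cases
    case 1
    then show ?thesis using attachment_join[OF R t t'] tt' by blast
  next
    case 2
    then show ?thesis using attachment_switch[OF R t t' ne p'] n by blast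
  next
    case 3
    then show ?thesis using attachment_switch[OF R t' t ne[symmetric] p] n by (simp add: insert_commute)
  qed
qed

section \<open>Repairing the parity\<close>

text \<open>The edge set of the desired trail. As \<open>f\<close> may be any set, at most one cycle
  edge is missing, possibly none.\<close>

definition good :: "'a set set \<Rightarrow> bool" where
  "good H \<longleftrightarrow> H \<subseteq> E \<and> (\<forall>v\<in>V. deg H v = 2 \<or> deg H v = 4) \<and> (\<exists>f. EC - {f} \<subseteq> H)"

text \<open>\<open>H\<close> contains a path through all of \<open>K\<close>, and each edge of
  \<open>H\<close> meets \<open>K\<close> because \<open>I\<close> is independent, so
  \<open>H\<close> is connected. An Euler tour visits a vertex half as often as its degree, hence at
  most twice.\<close>

lemma good_spanning_trail:
  assumes "good H"
  shows "\<exists>p. p \<noteq> [] \<and> hd p = last p \<and> set p = V \<and> set (vwalk_edges p) \<subseteq> E \<and>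
    distinct (vwalk_edges p) \<and> (\<forall>v. count_list (tl p) v \<le> 2)"
proof -
  from assms obtain f where HE: "H \<subseteq> E" and dg: "\<And>v. v \<in> V \<Longrightarrow> deg H v = 2 \<or> deg H v = 4"
    and f: "EC - {f} \<subseteq> H" unfolding good_def by blast
  have finH: "finite H" using HE finite_E finite_subset by blast
  have two: "card e = 2" if e: "e \<in> H" for e
  proof -
    have "e \<in> E" using e HE by blast
    from edge[OF this] show ?thesis by (metis card_2_iff)
  qed
  have inc: "\<exists>e\<in>H. v \<in> e" if "v \<in> V" for v
  proof (rule ccontr)
    assume "\<not> (\<exists>e\<in>H. v \<in> e)"
    then have "deg H v = 0" by (intro deg_eq_0) blast
    then show False using dg[OF that] by simp
  qed
  have out: "deg H v = 0" if "v \<notin> V" for v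
  proof -
    have "v \<notin> e" if e: "e \<in> H" for e
    proof -
      have "e \<in> E" using e HE by blast
      from edge[OF this] show ?thesis using \<open>v \<notin> V\<close> by blast
    qed
    then show ?thesis by (rule deg_eq_0)
  qed
  have meets: "e \<inter> K \<noteq> {}" if e: "e \<in> H" for e
  proof -
    have eE: "e \<in> E" using e HE by blast
    from edge[OF this] obtain u v where uv: "u \<in> V" "v \<in> V" "e = {u, v}" by blast
    then show ?thesis using I_independent[of u v] eE by auto
  qed
  have conn: "linked H (\<Union>H)"
  proof (rule linkedI)
    fix X assume X: "X \<inter> \<Union>H \<noteq> {}" and cl: "\<And>e. e \<in> H \<Longrightarrow> e \<inter> X \<noteq> {} \<Longrightarrow> e \<subseteq> X"
    obtain e where e: "e \<in> H" "e \<inter> X \<noteq> {}" using X by blast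
    have "K \<subseteq> X"
    proof (rule linkedD[OF linked_cycle_remove_edge[OF distinct_C length_C, of f]])
      show "X \<inter> K \<noteq> {}" using cl[OF e] meets[OF e(1)] by blast
      show "e' \<subseteq> X" if "e' \<in> EC - {f}" "e' \<inter> X \<noteq> {}" for e' using cl that f by blast
    qed
    then have "e \<subseteq> X" if "e \<in> H" for e using meets[OF that] cl[OF that] by blast
    then show "\<Union>H \<subseteq> X" by blast
  qed
  have "V \<noteq> {}" using card_V by auto
  then have "H \<noteq> {}" using inc by blast
  moreover have "even (deg H v)" for v
  proof (cases "v \<in> V")
    case True
    then show ?thesis using dg[OF True] by auto
  qed (simp add: out)
  ultimately obtain p where p: "p \<noteq> []" "hd p = last p" "distinct (vwalk_edges p)" "set (vwalk_edges p) = H"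
    using euler[OF finH two _ _ conn] by blast
  have "vwalk_edges p \<noteq> []" using p(4) \<open>H \<noteq> {}\<close> by auto
  then have "length p - 1 > 0" by (metis length_greater_0_conv length_vwalk_edges)
  then have "2 \<le> length p" by simp
  then have "set p = \<Union>H" using vwalk_edges_cover[of p] vwalk_edges_subset[of _ p] p(4) by blast
  moreover have "\<Union>H = V" using inc HE edge by blast
  moreover have "count_list (tl p) v \<le> 2" for v
  proof -
    \<comment> \<open>The start is listed at both ends of \<open>p\<close>; dropping the head in
      \<open>tl p\<close> cancels the surplus.\<close>
    have "2 * count_list p v = length (filter (\<lambda>e. v \<in> e) (vwalk_edges p)) + of_bool (v = hd p) + of_bool (v = last p)"
      using two p(4) by (intro count_vwalk_edges[OF p(1)]) blast
    also have "length (filter (\<lambda>e. v \<in> e) (vwalk_edges p)) = deg H v"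
      by (simp add: length_filter_distinct[OF p(3)] p(4) deg_def)
    finally have "2 * count_list p v = deg H v + 2 * of_bool (v = hd p)" using p(2) by simp
    moreover have "count_list p v = count_list (tl p) v + of_bool (v = hd p)"
      using p(1) by (cases p) auto
    moreover have "deg H v \<le> 4" using dg[of v] out[of v] by (cases "v \<in> V") auto
    ultimately show ?thesis by linarith
  qed
  ultimately show ?thesis using p HE by blast
qed

text \<open>In \<open>EC \<union> R\<close> the degree is 3 at \<open>s\<close> and at the loose
  vertices, and 2 or 4 elsewhere. So the exchange has to change the former by one, while the others
  keep their degree or drop from 4 to 2. Only one cycle edge \<open>f\<close> may go.\<close>

lemma good_toggle:
  assumes R: "attachment s R" and s: "s \<in> I"
    and Add: "Add \<subseteq> E" "Add \<inter> (EC \<union> R) = {}" and Rem: "Rem \<subseteq> EC \<union> R" "Rem \<inter> EC \<subseteq> {f}"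
    and odd: "\<And>v. v \<in> insert s (loose R) \<Longrightarrow> deg Add v = deg Rem v + 1 \<or> deg Rem v = deg Add v + 1"
    and even: "\<And>v. v \<in> V \<Longrightarrow> v \<notin> loose R \<Longrightarrow> v \<noteq> s \<Longrightarrow>
      deg Add v = deg Rem v \<or> v \<in> K \<and> deg R v = 2 \<and> deg Rem v = deg Add v + 2"
  shows "\<exists>H. good H"
proof -
  define H where "H = ((EC \<union> R) - Rem) \<union> Add"
  have RE: "R \<subseteq> E" "R \<inter> EC = {}" using R unfolding attachment_def by blast+
  have finR: "finite R" by (rule finite_attachment[OF R])
  have finA: "finite Add" using Add(1) finite_E finite_subset by blast
  have tog: "deg H v + deg Rem v = deg (EC \<union> R) v + deg Add v" for v
    unfolding H_def using finR finite_EC finA Add(2) Rem(1) by (intro deg_toggle) auto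
  have "deg (EC \<union> R) v = deg EC v + deg R v" for v
    using finR finite_EC RE(2) by (intro deg_Un) auto
  then have dH: "deg H v + deg Rem v = deg EC v + deg R v + deg Add v" for v
    using tog by simp
  have "deg H v = 2 \<or> deg H v = 4" if v: "v \<in> V" for v
  proof (cases "v \<in> insert s (loose R)")
    case True
    then have "deg EC v + deg R v = 3"
      using R s by (auto simp: attachment_def demand_def loose_def deg_EC)
    then show ?thesis using odd[OF True] dH[of v] by linarith
  next
    case False
    then have ev: "deg Add v = deg Rem v \<or> v \<in> K \<and> deg R v = 2 \<and> deg Rem v = deg Add v + 2"
      using even v by blast
    have "deg EC v + deg R v = 2 \<or> deg EC v + deg R v = 4 \<and> v \<in> K"
    proof (cases "v \<in> K")
      case True
      then have "deg R v \<le> 2" "deg R v \<noteq> 1"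
        using R False unfolding attachment_def loose_def by auto
      then show ?thesis using True by (auto simp: deg_EC)
    next
      case False
      then show ?thesis using R v \<open>v \<notin> insert s (loose R)\<close>
        by (simp add: deg_EC attachment_def demand_def)
    qed
    then show ?thesis using ev dH[of v] deg_EC[of v] by auto
  qed
  moreover have "H \<subseteq> E" using RE EC_subset Add(1) unfolding H_def by blast
  moreover have "EC - {f} \<subseteq> H" using Rem(2) unfolding H_def by blast
  ultimately have "good H" unfolding good_def by blast
  then show ?thesis by blast
qed

section \<open>One loose vertex\<close>

lemma attachment_edge:
  assumes "attachment s R" "e \<in> R"
  shows "e \<in> E" "e \<notin> EC"
  using assms unfolding attachment_def by blast+

lemma attachment_neighbours:
  assumes R: "attachment s R" and v: "v \<in> I"
  shows "card {z. {v, z} \<in> R} = demand s v" "{z. {v, z} \<in> R} \<subseteq> K"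
proof -
  have RE: "R \<subseteq> E" using R unfolding attachment_def by blast
  show "card {z. {v, z} \<in> R} = demand s v"
    using R v deg_eq_card_nb[OF RE, of v] by (simp add: attachment_def)
  show "{z. {v, z} \<in> R} \<subseteq> K" using nb_I[OF v] RE by (auto simp: nb_def)
qed

text \<open>Only \<open>t\<close> and \<open>s\<close> are odd. Deleting or adding
  \<open>{t, s}\<close> repairs both if possible; otherwise 2K2-freeness is applied to
  \<open>{t, p}\<close> and an edge \<open>{s, k}\<close> of \<open>R\<close>.\<close>

lemma one_loose:
  assumes R: "attachment s R" and s: "s \<in> I" and t: "loose R = {t}"
  shows "\<exists>H. good H"
proof -
  have tK: "t \<in> K" using t by (auto simp: loose_def)
  then have ts: "t \<noteq> s" using s by auto
  obtain p where p: "p \<in> I" "{t, p} \<in> R" and uniq: "\<And>x. {t, x} \<in> R \<Longrightarrow> x = p"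
    using loose_partner[OF R, of t] t by blast
  have tp: "t \<noteq> p" using tK p by auto
  have tsEC: "{t, s} \<notin> EC" using EC_subset_K s by blast
  have tpE: "{t, p} \<in> E" "{t, p} \<notin> EC" using attachment_edge[OF R p(2)] by auto
  consider "p = s" | "p \<noteq> s" "{t, s} \<in> E" | "p \<noteq> s" "{t, s} \<notin> E" by blast
  then show ?thesis
  proof cases
    case 1
    show ?thesis
      using p 1 ts tsEC by (intro good_toggle[OF R s, of "{}" "{{t, s}}" "{}"]) (auto simp: t deg_empty deg_single)
  next
    case 2
    have "{t, s} \<notin> R" using uniq 2 by blast
    then show ?thesis
      using 2 ts tsEC by (intro good_toggle[OF R s, of "{{t, s}}" "{}" "{}"]) (auto simp: t deg_empty deg_single)
  next
    case 3
    let ?S = "{z. {s, z} \<in> R}" and ?P = "{z. {p, z} \<in> R}"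
    \<comment> \<open>Here \<open>s\<close> has three \<open>R\<close>-neighbours but
      \<open>p\<close> only two.\<close>
    have "\<not> ?S \<subseteq> ?P"
    proof
      assume sub: "?S \<subseteq> ?P"
      have "t \<notin> ?S" using uniq[of s] 3 by (auto simp: insert_commute)
      moreover have "t \<in> ?P" using p by (simp add: insert_commute)
      ultimately have "?S \<subset> ?P" using sub by blast
      moreover have "finite ?P" using attachment_neighbours(2)[OF R p(1)] finite_subset by blast
      ultimately have "card ?S < card ?P" by (intro psubset_card_mono)
      then show False
        using attachment_neighbours(1)[OF R s] attachment_neighbours(1)[OF R p(1)] 3 by (simp add: demand_def)
    qed
    then obtain k where k: "{s, k} \<in> R" "{p, k} \<notin> R" by blast
    have kK: "k \<in> K" using attachment_neighbours(2)[OF R s] k by blast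
    have ne: "k \<noteq> t" "k \<noteq> s" "k \<noteq> p" using k p kK s by (auto simp: insert_commute)
    have skE: "{s, k} \<in> E" "{s, k} \<notin> EC" using attachment_edge[OF R k(1)] by auto
    have "{t, s} \<in> E \<or> {t, k} \<in> E \<or> {p, s} \<in> E \<or> {p, k} \<in> E"
      using 3 ne ts by (intro free[OF tpE(1) skE(1)]) auto
    \<comment> \<open>In turn: exchange \<open>{t, p}\<close> and \<open>{s, k}\<close> for
      \<open>{p, k}\<close>; exchange \<open>{s, k}\<close> for \<open>{t, k}\<close>; or, if
      \<open>{t, k}\<close> lies on the cycle, delete both \<open>{t, k}\<close> and
      \<open>{s, k}\<close>.\<close>
    then consider "{p, k} \<in> E" | "{t, k} \<in> E" "{t, k} \<notin> EC" | "{t, k} \<in> EC"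
      using 3 I_independent[OF p(1) s] by blast
    then show ?thesis
    proof cases
      case 1
      have "{p, k} \<notin> EC" using EC_subset_K[of p k] p by blast
      have "{t, p} \<noteq> {s, k}" using ne ts by (auto simp: doubleton_eq_iff)
      then have Rem: "deg {{t, p}, {s, k}} v = of_bool (v \<in> {t, p}) + of_bool (v \<in> {s, k})" for v
        by (rule deg_pair)
      show ?thesis
      proof (rule good_toggle[OF R s])
        show "{{p, k}} \<subseteq> E" using 1 by simp
        show "{{p, k}} \<inter> (EC \<union> R) = {}" using \<open>{p, k} \<notin> EC\<close> k by simp
        show "{{t, p}, {s, k}} \<subseteq> EC \<union> R" using p k by simp
        show "{{t, p}, {s, k}} \<inter> EC \<subseteq> {{}}" using tpE skE by simp
        show "deg {{p, k}} v = deg {{t, p}, {s, k}} v + 1 \<or> deg {{t, p}, {s, k}} v = deg {{p, k}} v + 1"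
          if "v \<in> insert s (loose R)" for v
          using that ne ts tp 3(1) unfolding Rem deg_single t by auto
        show "deg {{p, k}} v = deg {{t, p}, {s, k}} v \<or>
            v \<in> K \<and> deg R v = 2 \<and> deg {{t, p}, {s, k}} v = deg {{p, k}} v + 2"
          if "v \<notin> loose R" "v \<noteq> s" for v
          using that ne ts tp 3(1) unfolding Rem deg_single t by auto
      qed
    next
      case 2
      have "{t, k} \<notin> R" using uniq ne by blast
      then show ?thesis
        using 2 k ne ts skE
        by (intro good_toggle[OF R s, of "{{t, k}}" "{{s, k}}" "{}"]) (auto simp: t deg_single)
    next
      case 3
      \<comment> \<open>As \<open>t\<close> is the only loose vertex, \<open>k\<close> has total
        degree 4 and can afford to lose two edges.\<close>
      have "deg R k > 0" using deg_pos[OF finite_attachment[OF R] k(1)] by simp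
      moreover have "deg R k \<le> 2" using R kK unfolding attachment_def by blast
      moreover have "deg R k \<noteq> 1" using t kK ne by (auto simp: loose_def)
      ultimately have "deg R k = 2" by linarith
      moreover have "{t, k} \<noteq> {s, k}" using ts by (auto simp: doubleton_eq_iff)
      ultimately show ?thesis
        using 3 k ne ts skE kK
        by (intro good_toggle[OF R s, of "{}" "{{t, k}, {s, k}}" "{t, k}"]) (auto simp: t deg_empty deg_pair)
    qed
  qed
qed

section \<open>Three loose vertices\<close>

lemma star_switch:
  assumes R: "attachment s R" and s: "s \<in> I" and T: "loose R = {a, b, c}" and dist: "distinct [a, b, c]"
    and star: "{a, s} \<in> R" "{b, s} \<in> R" "{c, s} \<in> R"
    and y: "{b, y} \<in> EC" "{a, y} \<in> E" "{a, y} \<notin> EC"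
  shows "\<exists>H. good H"
proof -
  have K: "a \<in> K" "b \<in> K" "c \<in> K" using T by (auto simp: loose_def)
  have ya: "y \<in> K" using EC_subset_K[OF y(1)] by simp
  have sK: "s \<notin> K" using s by simp
  have nE: "{s, y} \<notin> E"
    using not_consecutive[OF y(1) sK] attachment_edge(1)[OF R star(2)] by (auto simp: insert_commute)
  have "{s, c} \<in> E" "{s, a} \<in> E" "{s, b} \<in> E"
    using attachment_edge(1)[OF R] star by (auto simp: insert_commute)
  then have ne: "y \<noteq> a" "y \<noteq> b" "y \<noteq> c" "y \<noteq> s" "a \<noteq> s" "b \<noteq> s" "c \<noteq> s" using nE K ya sK by auto
  have "deg R a = 1" using T by (auto simp: loose_def)
  then have "{a, y} \<notin> R" using deg_1_unique[of R a "{a, y}" "{a, s}"] star ne by (auto simp: doubleton_eq_iff)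
  moreover have "{b, y} \<noteq> {c, s}" using ne dist by (auto simp: doubleton_eq_iff)
  moreover have "{c, s} \<notin> EC" using attachment_edge(2)[OF R star(3)] .
  \<comment> \<open>The degree of \<open>a\<close> rises, those of \<open>b\<close>,
    \<open>c\<close> and \<open>s\<close> drop, and at \<open>y\<close> the new edge makes up for
    the deleted cycle edge.\<close>
  ultimately show ?thesis
    using y star ne dist
    by (intro good_toggle[OF R s, of "{{a, y}}" "{{b, y}, {c, s}}" "{b, y}"])
       (auto simp: T deg_single deg_pair)
qed

text \<open>If \<open>{a, b}\<close> were an edge, adding it and deleting \<open>{c, s}\<close>
  would repair everything. So 2K2-freeness for the cycle edges \<open>{a, x}\<close> and
  \<open>{b, y}\<close> from \<open>crossing_missing\<close> yields \<open>{a, y}\<close> or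
  \<open>{b, x}\<close>, and by \<open>star_switch\<close> this must be a cycle edge.\<close>

lemma star_pair:
  assumes R: "attachment s R" and s: "s \<in> I" and T: "loose R = {a, b, c}" and dist: "distinct [a, b, c]"
    and star: "{a, s} \<in> R" "{b, s} \<in> R" "{c, s} \<in> R" and no: "\<nexists>H. good H"
  shows "\<exists>q. {a, q} \<in> EC \<and> {b, q} \<in> EC"
proof -
  have K: "a \<in> K" "b \<in> K" "c \<in> K" using T by (auto simp: loose_def)
  have sK: "s \<notin> K" using s by simp
  then have ne: "a \<noteq> s" "b \<noteq> s" "c \<noteq> s" using K by auto
  have sE: "{s, a} \<in> E" "{s, b} \<in> E"
    using attachment_edge(1)[OF R] star by (auto simp: insert_commute)
  have ab: "{a, b} \<notin> E"
  proof
    assume ab: "{a, b} \<in> E"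
    have "{a, b} \<notin> EC" using not_consecutive[OF _ sK sE] by blast
    moreover have "deg R a = 1" using T by (auto simp: loose_def)
    then have "{a, b} \<notin> R" using deg_1_unique[of R a "{a, b}" "{a, s}"] star ne by (auto simp: doubleton_eq_iff)
    moreover have "{c, s} \<notin> EC" using attachment_edge(2)[OF R star(3)] .
    ultimately have "\<exists>H. good H"
      using ab star ne dist
      by (intro good_toggle[OF R s, of "{{a, b}}" "{{c, s}}" "{}"]) (auto simp: T deg_single)
    then show False using no by blast
  qed
  obtain x y where xy: "{a, x} \<in> EC" "{b, y} \<in> EC" "x \<noteq> y" "{x, y} \<notin> E"
    using crossing_missing[OF s sE] dist by auto
  have E: "{a, x} \<in> E" "{b, y} \<in> E" using xy EC_subset by auto
  have "{a, b} \<in> E \<or> {a, y} \<in> E \<or> {x, b} \<in> E \<or> {x, y} \<in> E"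
    using dist xy ab E by (intro free) (auto simp: insert_commute)
  then consider "{a, y} \<in> E" | "{b, x} \<in> E" using ab xy by (auto simp: insert_commute)
  then show ?thesis
  proof cases
    case 1
    then have "{a, y} \<in> EC" using star_switch[OF R s T dist star xy(2)] no by blast
    then show ?thesis using xy by blast
  next
    case 2
    have "loose R = {b, a, c}" "distinct [b, a, c]" using T dist by auto
    then have "{b, x} \<in> EC"
      using star_switch[OF R s _ _ star(2) star(1) star(3) xy(1) 2] no by blast
    then show ?thesis using xy by blast
  qed
qed

text \<open>Otherwise each two of \<open>a\<close>, \<open>b\<close>, \<open>c\<close> have a common
  cycle neighbour. These three are distinct, since no vertex has three cycle neighbours, so the
  cycle is a hexagon, which is too short.\<close>

lemma star_loose:
  assumes R: "attachment s R" and s: "s \<in> I" and T: "loose R = {a, b, c}" and dist: "distinct [a, b, c]"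
    and star: "{a, s} \<in> R" "{b, s} \<in> R" "{c, s} \<in> R"
  shows "\<exists>H. good H"
proof (rule ccontr)
  assume no: "\<nexists>H. good H"
  obtain x where x: "{a, x} \<in> EC" "{b, x} \<in> EC"
    using star_pair[OF R s T dist star no] by blast
  have "loose R = {b, c, a}" "distinct [b, c, a]" using T dist by auto
  then obtain y where y: "{b, y} \<in> EC" "{c, y} \<in> EC"
    using star_pair[OF R s _ _ star(2) star(3) star(1) no] by blast
  have "loose R = {a, c, b}" "distinct [a, c, b]" using T dist by auto
  then obtain z where z: "{a, z} \<in> EC" "{c, z} \<in> EC"
    using star_pair[OF R s _ _ star(1) star(3) star(2) no] by blast
  have com: "{v, w} \<in> EC \<longleftrightarrow> {w, v} \<in> EC" for v w by (simp add: insert_commute)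
  have three: "\<not> ({a, q} \<in> EC \<and> {b, q} \<in> EC \<and> {c, q} \<in> EC)" for q
    using EC_three_nb[of q a b c] dist by (auto simp: com[of q])
  have ne: "x \<noteq> y" "x \<noteq> z" "y \<noteq> z" using three x y z by blast+
  define W where "W = {a, b, c, x, y, z}"
  have W: "a \<in> W" "b \<in> W" "c \<in> W" "x \<in> W" "y \<in> W" "z \<in> W" by (simp_all add: W_def)
  have "K \<subseteq> W"
  proof (rule EC_closed)
    show "a \<in> W" "a \<in> K" using T W by (auto simp: loose_def)
    fix v assume "v \<in> W"
    then consider "v = a" | "v = b" | "v = c" | "v = x" | "v = y" | "v = z" unfolding W_def by blast
    then show "\<exists>y'\<in>W. \<exists>z'\<in>W. y' \<noteq> z' \<and> {v, y'} \<in> EC \<and> {v, z'} \<in> EC"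
    proof cases
      case 1 then show ?thesis using W x z ne by blast
    next
      case 2 then show ?thesis using W x y ne by blast
    next
      case 3 then show ?thesis using W y z ne by blast
    next
      case 4 then show ?thesis using W x com[of x] dist by (intro bexI[of _ a] bexI[of _ b]) auto
    next
      case 5 then show ?thesis using W y com[of y] dist by (intro bexI[of _ b] bexI[of _ c]) auto
    next
      case 6 then show ?thesis using W z com[of z] dist by (intro bexI[of _ a] bexI[of _ c]) auto
    qed
  qed
  then have "K \<subseteq> {a, b, c, x, y, z}" unfolding W_def .
  then have "card K \<le> card {a, b, c, x, y, z}" by (intro card_mono) auto
  also have "\<dots> \<le> 6" using card_length[of "[a, b, c, x, y, z]"] by simp
  finally show False using card_K_ge_7[OF s] by simp
qed

lemma two_paired_loose:
  assumes R: "attachment s R" and s: "s \<in> I" and T: "loose R = {a, b, c}" and dist: "distinct [a, b, c]"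
    and p: "p \<in> I" "{a, p} \<in> R" "{b, p} \<in> R" and EC: "{a, c} \<in> EC" "{b, c} \<in> EC"
  shows "\<exists>H. good H"
proof -
  have K: "a \<in> K" "b \<in> K" "c \<in> K" and d1: "deg R a = 1" "deg R b = 1" using T by (auto simp: loose_def)
  have sK: "s \<notin> K" and pK: "p \<notin> K" using s p by auto
  then have ne: "a \<noteq> s" "b \<noteq> s" "c \<noteq> s" "a \<noteq> p" "b \<noteq> p" "c \<noteq> p" using K by auto
  have outEC: "{v, s} \<notin> EC" "{v, p} \<notin> EC" for v using EC_subset_K sK pK by blast+
  have uniq: "x = p" if "{a, x} \<in> R \<or> {b, x} \<in> R" for x
    using that deg_1_unique[OF d1(1) p(2), of "{a, x}"] deg_1_unique[OF d1(2) p(3), of "{b, x}"]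
    by (auto simp: doubleton_eq_iff)
  have acs: "{a, c} \<noteq> {b, v}" "{a, c} \<noteq> {k, s}" for v k
    using dist ne by (auto simp: doubleton_eq_iff)
  consider "p = s" | "p \<noteq> s" "{b, s} \<in> E" | "p \<noteq> s" "{b, s} \<notin> E" by blast
  then show ?thesis
  proof cases
    case 1
    then show ?thesis
      using p EC ne dist outEC acs(1)[of s]
      by (intro good_toggle[OF R s, of "{}" "{{a, c}, {b, s}}" "{a, c}"]) (auto simp: T deg_empty deg_pair)
  next
    case 2
    have "{b, s} \<notin> R" using uniq 2 by blast
    then show ?thesis
      using 2 EC ne dist outEC
      by (intro good_toggle[OF R s, of "{{b, s}}" "{{a, c}}" "{a, c}"]) (auto simp: T deg_single)
  next
    case 3
    let ?S = "{z. {s, z} \<in> R}"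
    \<comment> \<open>Here \<open>s\<close> has three \<open>R\<close>-neighbours and
      \<open>b\<close> two cycle neighbours. The choice makes \<open>{b, k}\<close> available as a
      new edge and keeps \<open>k\<close> different from the cycle neighbour \<open>c\<close> of
      \<open>b\<close>.\<close>
    have "\<not> ?S \<subseteq> {z. {b, z} \<in> EC}"
    proof
      assume sub: "?S \<subseteq> {z. {b, z} \<in> EC}"
      obtain x y where xy: "{z. {b, z} \<in> EC} = {x, y}" using EC_nb[OF K(2)] by blast
      have "card ?S \<le> card {x, y}" using sub unfolding xy by (intro card_mono) auto
      then show False
        using attachment_neighbours(1)[OF R s] card_length[of "[x, y]"] by (simp add: demand_def)
    qed
    then obtain k where k: "{s, k} \<in> R" "{b, k} \<notin> EC" by blast
    have kK: "k \<in> K" using attachment_neighbours(2)[OF R s] k by blast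
    have ks: "{k, s} \<in> R" using k(1) by (simp add: insert_commute)
    have "k \<noteq> a" "k \<noteq> b" using ks uniq[of s] 3(1) by blast+
    moreover have "k \<noteq> c" "k \<noteq> s" "k \<noteq> p" using k(2) EC kK sK pK by auto
    ultimately have kne: "k \<noteq> a" "k \<noteq> b" "k \<noteq> c" "k \<noteq> s" "k \<noteq> p" .
    have "{b, p} \<in> E" "{s, k} \<in> E" using attachment_edge(1)[OF R] p k by auto
    then have "{b, s} \<in> E \<or> {b, k} \<in> E \<or> {p, s} \<in> E \<or> {p, k} \<in> E"
      using kne ne 3 by (intro free) auto
    then consider "{b, k} \<in> E" | "{p, k} \<in> E"
      using 3 I_independent[OF p(1) s] by blast
    then show ?thesis
    proof cases
      case 1
      have "{b, k} \<notin> R" using uniq kne by blast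
      then show ?thesis
        using 1 k ks kne EC ne dist outEC acs(2)[of k]
        by (intro good_toggle[OF R s, of "{{b, k}}" "{{a, c}, {k, s}}" "{a, c}"])
           (auto simp: T deg_single deg_pair)
    next
      case 2
      \<comment> \<open>The two \<open>R\<close>-neighbours of \<open>p\<close> are \<open>a\<close>
        and \<open>b\<close>, so \<open>{p, k}\<close> is a new edge.\<close>
      have "card {z. {p, z} \<in> R} = 2"
        using attachment_neighbours(1)[OF R p(1)] 3 by (simp add: demand_def)
      moreover have "{a, b} \<subseteq> {z. {p, z} \<in> R}" using p by (simp add: insert_commute)
      moreover have "finite {z. {p, z} \<in> R}" using attachment_neighbours(2)[OF R p(1)] finite_subset by blast
      ultimately have "{a, b} = {z. {p, z} \<in> R}" using dist by (intro card_subset_eq) auto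
      then have "{p, k} \<notin> R" using kne by blast
      moreover have "{p, k} \<notin> EC" using EC_subset_K pK by blast
      moreover have "{b, p} \<noteq> {k, s}" using kne ne by (auto simp: doubleton_eq_iff)
      ultimately show ?thesis
        using 2 p ks kne EC ne dist outEC acs(2)[of k] acs(1)[of p] 3(1)
        by (intro good_toggle[OF R s, of "{{p, k}}" "{{a, c}, {b, p}, {k, s}}" "{a, c}"])
           (auto simp: T deg_single deg_triple)
    qed
  qed
qed

section \<open>Bounding the number of loose vertices and the final cases\<close>

lemma card_paired_loose:
  assumes R: "attachment s R" and p: "p \<in> I"
  shows "card {t \<in> loose R. {t, p} \<in> R} \<le> demand s p"
proof -
  have "{t \<in> loose R. {t, p} \<in> R} \<subseteq> {z. {p, z} \<in> R}" by (auto simp: insert_commute)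
  moreover have "finite {z. {p, z} \<in> R}" using attachment_neighbours(2)[OF R p] finite_subset by blast
  ultimately have "card {t \<in> loose R. {t, p} \<in> R} \<le> card {z. {p, z} \<in> R}" by (intro card_mono)
  then show ?thesis using attachment_neighbours(1)[OF R p] by simp
qed

text \<open>Every loose vertex shares the partner \<open>p\<close> of \<open>t\<close> or is one of
  the two cycle neighbours of \<open>t\<close>. So five loose vertices force a partner of demand 3,
  which is \<open>s\<close>, for each of them; but \<open>s\<close> serves only three.\<close>

lemma card_loose_le_4:
  assumes R: "attachment s R" and irreducible: "\<And>t t' p p'. t \<in> loose R \<Longrightarrow> t' \<in> loose R \<Longrightarrow> t \<noteq> t' \<Longrightarrow>
      {t, p} \<in> R \<Longrightarrow> {t', p'} \<in> R \<Longrightarrow> p \<in> I \<Longrightarrow> p' \<in> I \<Longrightarrow> p \<noteq> p' \<Longrightarrow> {t, t'} \<in> EC"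
  shows "card (loose R) \<le> 4"
proof (rule ccontr)
  assume five: "\<not> card (loose R) \<le> 4"
  have finT: "finite (loose R)" by (simp add: loose_def)
  have all_s: "{t, s} \<in> R" if t: "t \<in> loose R" for t
  proof -
    obtain p where p: "p \<in> I" "{t, p} \<in> R" using loose_partner[OF R t] by blast
    have "t \<in> K" using t by (simp add: loose_def)
    then obtain x y where xy: "{z. {t, z} \<in> EC} = {x, y}" using EC_nb by blast
    have "loose R \<subseteq> {t' \<in> loose R. {t', p} \<in> R} \<union> {x, y}"
    proof
      fix t' assume t': "t' \<in> loose R"
      obtain p' where p': "p' \<in> I" "{t', p'} \<in> R" using loose_partner[OF R t'] by blast
      show "t' \<in> {t' \<in> loose R. {t', p} \<in> R} \<union> {x, y}"
      proof (cases "t = t' \<or> p = p'")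
        case True
        then show ?thesis using t t' p p' by auto
      next
        case False
        then have "t' \<in> {z. {t, z} \<in> EC}" using irreducible[OF t t' _ p(2) p'(2) p(1) p'(1)] by blast
        then show ?thesis unfolding xy by blast
      qed
    qed
    then have "card (loose R) \<le> card ({t' \<in> loose R. {t', p} \<in> R} \<union> {x, y})"
      using finT by (intro card_mono) auto
    also have "\<dots> \<le> card {t' \<in> loose R. {t', p} \<in> R} + card {x, y}" by (rule card_Un_le)
    also have "card {x, y} \<le> 2" using card_length[of "[x, y]"] by simp
    finally have "3 \<le> demand s p" using five card_paired_loose[OF R p(1)] by linarith
    then show ?thesis using p by (simp add: demand_def split: if_splits)
  qed
  have "loose R \<noteq> {}" using five by auto
  then obtain t where t: "t \<in> loose R" by blast
  then have "s \<in> V" using edgeD(2) attachment_edge(1)[OF R all_s[OF t]] by blast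
  moreover have "s \<notin> K"
    using loose_partner[OF R t] all_s[OF t] by (metis DiffD2)
  ultimately have s: "s \<in> I" by simp
  have "{t \<in> loose R. {t, s} \<in> R} = loose R" using all_s by blast
  then show False using card_paired_loose[OF R s] five by (simp add: demand_def)
qed

lemma exists_good_of_I:
  assumes s: "s \<in> I"
  shows "\<exists>H. good H"
proof -
  obtain R0 where "attachment s R0" using attachment_exists by blast
  then obtain R where R: "attachment s R" and min: "\<And>R'. attachment s R' \<Longrightarrow> card (loose R) \<le> card (loose R')"
    using ex_has_least_nat[of "attachment s" R0 "\<lambda>R. card (loose R)"] by blast
  have finT: "finite (loose R)" by (simp add: loose_def)
  have irreducible: "{t, t'} \<in> EC"
    if t: "t \<in> loose R" "t' \<in> loose R" "t \<noteq> t'" and p: "{t, p} \<in> R" "{t', p'} \<in> R" "p \<in> I" "p' \<in> I" "p \<noteq> p'"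
    for t t' p p'
  proof (rule ccontr)
    assume "{t, t'} \<notin> EC"
    then obtain R' where R': "attachment s R'" "loose R' = loose R - {t, t'}"
      using attachment_reduce[OF R t p(3) p(1) p(4) p(2) p(5)] by blast
    have "loose R' \<subset> loose R" using R'(2) t by blast
    then have "card (loose R') < card (loose R)" using finT by (intro psubset_card_mono)
    then show False using min[OF R'(1)] by simp
  qed
  have "card (loose R) \<le> 4" using card_loose_le_4[OF R] irreducible by blast
  moreover have "odd (card (loose R))" by (rule odd_loose[OF R s])
  ultimately have "card (loose R) = 1 \<or> card (loose R) = 3" by presburger
  then show ?thesis
  proof
    assume "card (loose R) = 1"
    then obtain t where "loose R = {t}" by (auto simp: card_1_singleton_iff)
    then show ?thesis by (rule one_loose[OF R s])
  next
    assume "card (loose R) = 3"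
    then obtain a b c where T: "loose R = {a, b, c}" and ne: "a \<noteq> b" "a \<noteq> c" "b \<noteq> c"
      by (auto simp: card_3_iff)
    have mem: "a \<in> loose R" "b \<in> loose R" "c \<in> loose R" using T by auto
    obtain p where p: "p \<in> I" "{a, p} \<in> R" using loose_partner[OF R mem(1)] by blast
    obtain q where q: "q \<in> I" "{b, q} \<in> R" using loose_partner[OF R mem(2)] by blast
    obtain r where r: "r \<in> I" "{c, r} \<in> R" using loose_partner[OF R mem(3)] by blast
    have ab: "{a, b} \<in> EC" if "p \<noteq> q" using irreducible[OF mem(1,2) ne(1) p(2) q(2) p(1) q(1) that] .
    have ac: "{a, c} \<in> EC" if "p \<noteq> r" using irreducible[OF mem(1,3) ne(2) p(2) r(2) p(1) r(1) that] .
    have bc: "{b, c} \<in> EC" if "q \<noteq> r" using irreducible[OF mem(2,3) ne(3) q(2) r(2) q(1) r(1) that] .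
    have comm: "{v, w} = {w, v}" for v w :: 'a by (rule insert_commute)
    \<comment> \<open>If all partners agree, their demand is three and they equal \<open>s\<close>.
      If exactly two agree, the third loose vertex is a cycle neighbour of both others. If all
      differ, the cycle is a triangle, which is too short.\<close>
    consider "p = q" "q = r" | "p = q" "q \<noteq> r" | "p = r" "p \<noteq> q" | "q = r" "p \<noteq> q"
      | "p \<noteq> q" "q \<noteq> r" "p \<noteq> r" by blast
    then show ?thesis
    proof cases
      case 1
      then have "{t \<in> loose R. {t, p} \<in> R} = {a, b, c}" using T p q r by auto
      then have "3 \<le> demand s p" using card_paired_loose[OF R p(1)] ne by simp
      then have "p = s" by (simp add: demand_def split: if_splits)
      then show ?thesis using star_loose[OF R s T] ne p q r 1 by simp
    next
      case 2
      then show ?thesis using two_paired_loose[OF R s T _ p(1,2)] ne q ac bc by simp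
    next
      case 3
      have "loose R = {a, c, b}" using T by auto
      then show ?thesis
        using two_paired_loose[OF R s _ _ p(1,2), of c b] ne r 3 ab bc comm[of c b] by simp
    next
      case 4
      have "loose R = {b, c, a}" using T by auto
      then show ?thesis
        using two_paired_loose[OF R s _ _ q(1,2), of c a] ne r 4 ab ac comm[of b a] comm[of c a] by simp
    next
      case 5
      have E: "{a, b} \<in> EC" "{a, c} \<in> EC" "{b, c} \<in> EC" "{b, a} \<in> EC" "{c, a} \<in> EC" "{c, b} \<in> EC"
        using 5 ab ac bc comm by auto
      have "K \<subseteq> {a, b, c}"
      proof (rule EC_closed)
        show "a \<in> {a, b, c}" "a \<in> K" using EC_subset_K[OF E(1)] by simp_all
        fix v assume "v \<in> {a, b, c}"
        then consider "v = a" | "v = b" | "v = c" by blast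
        then show "\<exists>y\<in>{a, b, c}. \<exists>z\<in>{a, b, c}. y \<noteq> z \<and> {v, y} \<in> EC \<and> {v, z} \<in> EC"
          using E ne by cases auto
      qed
      then have "card K \<le> card {a, b, c}" by (intro card_mono) auto
      then show ?thesis using card_K_ge_7[OF s] ne by simp
    qed
  qed
qed

lemma exists_good: "\<exists>H. good H"
proof (cases "I = {}")
  case True
  then have "good EC" using EC_subset deg_EC unfolding good_def by auto
  then show ?thesis by blast
next
  case False
  then show ?thesis using exists_good_of_I by blast
qed

end

theorem (in tough_2K2_free) spanning_2_trail:
  "\<exists>p. p \<noteq> [] \<and> hd p = last p \<and> set p = V \<and> set (vwalk_edges p) \<subseteq> E \<and>
    distinct (vwalk_edges p) \<and> (\<forall>v. count_list (tl p) v \<le> 2)"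
proof -
  obtain C where "cyc C" "\<And>ys. cyc ys \<Longrightarrow> length ys \<le> length C" using ex_longest_cyc by blast
  then interpret longest_cycle V E C by unfold_locales
  show ?thesis using exists_good good_spanning_trail by blast
qed

section \<open>Transfer to digraphs\<close>

context graph begin

definition edge_sets :: "'a set set" where
  "edge_sets = {{u, v} | u v. (u, v) \<in> arcs_ends G}"

lemma doubleton_edge_sets: "{u, v} \<in> edge_sets \<longleftrightarrow> (u, v) \<in> arcs_ends G"
  using graph_symmetric unfolding edge_sets_def by (auto simp: doubleton_eq_iff)

lemma arcs_endsD:
  assumes "(u, v) \<in> arcs_ends G"
  shows "u \<in> verts G" "v \<in> verts G" "u \<noteq> v"
  using assms no_loops by (auto simp: arcs_ends_conv)

lemma two_K2_free_edges:
  assumes "two_K2_free G" "(a, b) \<in> arcs_ends G" "(c, d) \<in> arcs_ends G" "{a, b} \<inter> {c, d} = {}"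
  shows "(a, c) \<in> arcs_ends G \<or> (a, d) \<in> arcs_ends G \<or> (b, c) \<in> arcs_ends G \<or> (b, d) \<in> arcs_ends G"
proof (rule ccontr)
  assume no: "\<not> ?thesis"
  define H where "H = G \<restriction> {a, b, c, d}"
  have ab: "a \<in> verts G" "b \<in> verts G" "a \<noteq> b" and cd: "c \<in> verts G" "d \<in> verts G" "c \<noteq> d"
    using arcs_endsD assms(2,3) by blast+
  have "induced_subgraph H G"
    using ab cd unfolding H_def by (intro induced_induce) simp
  moreover have "is_2K2 H"
    unfolding is_2K2_def
  proof (intro exI conjI)
    show "distinct [a, b, c, d]" using ab cd assms(4) by auto
    show "verts H = {a, b, c, d}" by (simp add: H_def)
    have W: "arcs_ends H = {(x, y) \<in> arcs_ends G. x \<in> {a, b, c, d} \<and> y \<in> {a, b, c, d}}"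
      by (auto simp: H_def arcs_ends_conv)
    have sym: "(x, y) \<in> arcs_ends G \<longleftrightarrow> (y, x) \<in> arcs_ends G" for x y
      using graph_symmetric by blast
    have loop: "(x, x) \<notin> arcs_ends G" for x using arcs_endsD(3) by blast
    show "arcs_ends H = {(a, b), (b, a), (c, d), (d, c)}"
      unfolding W using assms(2,3) no loop sym[of c a] sym[of d a] sym[of c b] sym[of d b] sym[of a b] sym[of c d]
      by auto
  qed
  ultimately show False using assms(1) unfolding two_K2_free_def by blast
qed

text \<open>Distinct vertices of \<open>J\<close> lie in distinct components of
  \<open>G - S\<close>, so there are at least \<open>card J\<close> of them and toughness
  applies.\<close>

lemma tough_isolated:
  assumes tough: "tough (3 / 2) G" and S: "S \<subseteq> verts G" and J: "J \<subseteq> verts G - S" "2 \<le> card J"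
    and iso: "\<And>v w. v \<in> J \<Longrightarrow> v \<noteq> x \<Longrightarrow> (v, w) \<in> arcs_ends G \<Longrightarrow> w \<in> S"
  shows "3 * card J \<le> 2 * card S"
proof -
  define D where "D = delete_verts G S"
  interpret D: fin_digraph D
    unfolding D_def delete_verts_def by (rule fin_digraph.intro) (auto simp: fin_digraph_axioms_def)
  have vD: "verts D = verts G - S" by (simp add: D_def delete_verts_def)
  have aD: "w \<notin> S \<and> (v, w) \<in> arcs_ends G" if "(v, w) \<in> arcs_ends D" for v w
    using that by (auto simp: D_def delete_verts_def arcs_ends_conv)
  have stuck: "w = v" if "v \<rightarrow>\<^sup>*\<^bsub>D\<^esub> w" "v \<in> J" "v \<noteq> x" for v w
  proof -
    have "(v, w) \<in> (arcs_ends D)\<^sup>*" using that(1) unfolding reachable_def by (rule rtrancl_on_rtranclI)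
    then show ?thesis
      using iso[OF that(2,3)] aD by (metis converse_rtranclE)
  qed
  have "inj_on D.scc_of J"
  proof (rule inj_onI)
    fix v w assume vw: "v \<in> J" "w \<in> J" "D.scc_of v = D.scc_of w"
    have "w \<in> D.scc_of w" using vw J vD by (intro D.in_scc_of_self) auto
    then have "v \<rightarrow>\<^sup>*\<^bsub>D\<^esub> w" "w \<rightarrow>\<^sup>*\<^bsub>D\<^esub> v" using vw(3) by (auto simp: D.scc_of_def)
    \<comment> \<open>One of two distinct vertices would differ from \<open>x\<close>, and such a
      vertex reaches only itself.\<close>
    then show "v = w" using stuck vw by metis
  qed
  then have "card J = card (D.scc_of ` J)" by (simp add: card_image)
  also have "\<dots> \<le> card D.sccs_verts"
    using J vD D.scc_of_in_sccs_verts by (intro card_mono D.finite_sccs_verts) blast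
  also have "\<dots> = num_components D" by (simp add: num_components_def D.card_sccs_verts)
  finally have comp: "card J \<le> num_components D" .
  then have "real (card S) \<ge> 3 / 2 * real (num_components D)"
    using tough S J(2) unfolding tough_def D_def by auto
  then show ?thesis using comp by linarith
qed

end

theorem theorem1p4:
  fixes G :: "('a, 'b) pre_digraph"
  assumes "graph G"
    and "tough (3 / 2) G"
    and "two_K2_free G"
    and "card (verts G) \<ge> 3"
  shows "has_spanning_k_trail 2 G"
proof -
  interpret graph G by fact
  interpret T: tough_2K2_free "verts G" edge_sets
  proof
    show "finite (verts G)" by simp
    show "\<exists>u v. u \<in> verts G \<and> v \<in> verts G \<and> u \<noteq> v \<and> e = {u, v}" if "e \<in> edge_sets" for e
      using that arcs_endsD unfolding edge_sets_def by blast
    show "{a, c} \<in> edge_sets \<or> {a, d} \<in> edge_sets \<or> {b, c} \<in> edge_sets \<or> {b, d} \<in> edge_sets"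
      if "{a, b} \<in> edge_sets" "{c, d} \<in> edge_sets" "{a, b} \<inter> {c, d} = {}" for a b c d
      using two_K2_free_edges[OF assms(3)] that unfolding doubleton_edge_sets by blast
    show "3 * card J \<le> 2 * card S"
      if "S \<subseteq> verts G" "J \<subseteq> verts G - S" "2 \<le> card J"
        "\<And>v w. v \<in> J \<Longrightarrow> v \<noteq> x \<Longrightarrow> {v, w} \<in> edge_sets \<Longrightarrow> w \<in> S" for S J x
      using tough_isolated[OF assms(2) that(1-3)] that(4) unfolding doubleton_edge_sets by blast
    show "3 \<le> card (verts G)" by fact
  qed
  obtain p where p: "p \<noteq> []" "hd p = last p" "set p = verts G" "set (vwalk_edges p) \<subseteq> edge_sets"
    "distinct (vwalk_edges p)" "\<forall>v. count_list (tl p) v \<le> 2"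
    using T.spanning_2_trail by blast
  have "set (vwalk_arcs p) \<subseteq> arcs_ends G"
  proof
    fix a assume a: "a \<in> set (vwalk_arcs p)"
    obtain u v where uv: "a = (u, v)" by (cases a)
    \<comment> \<open>An edge determines its arc up to direction; the symmetry of the arcs, in
      \<open>doubleton_edge_sets\<close>, supplies the one needed.\<close>
    then have "{u, v} \<in> set (vwalk_edges p)" using a unfolding vwalk_edges_def by force
    then show "a \<in> arcs_ends G" using p(4) doubleton_edge_sets uv by blast
  qed
  then have "vwalk p G" using p by (auto simp: vwalk_def)
  then show ?thesis
    using p unfolding has_spanning_k_trail_def k_trail_def k_walk_def closed_vwalk_def by blast
qed

end
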